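(* Let $\nu>0$, $\alpha>2$ and $N_k=\lambda^k$ for $k\ge0$, for some $\lambda>1$. Then there exists $X=(X_k)_{k\ge1}$ with $X\in C((0,\infty);H^s)$ for all $s\in\mathbb R$, satisfying $$X_k'=-\nu N_k^2X_k+N_k^\alpha X_{k+1}^2-N_{k-1}^\alpha X_{k-1}X_k,\qquad k=1,2,\dots,\qquad X_0=0,$$ with $$\lim_{t\to0+}X_k(t)=0,\quad k=1,2,\dots,\qquad\text{and}\qquad\lim_{t\to0+}\|X(t)\|_{\ell^2}=1.$$ Further, for every $0<s<\alpha$ and $\varepsilon>0$, $$t^{-s/\alpha}\lesssim_s\|X(t)\|_{H^s}\lesssim_{s,\varepsilon}t^{-s/\alpha-\varepsilon},\qquad 0<t\le t_s,$$ for some $t_s>0$.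
   Context: For a real sequence $X=(X_k)_{k\ge1}$ and $s\in\mathbb R$, $\|X\|_{H^s}^2:=\sum_{k\ge1}N_k^{2s}X_k^2$, $H^s$ is the space of sequences with finite norm, and $H^0=\ell^2$. Solutions are understood componentwise: each $X_k$ is a continuous function of time that satisfies the $k$-th differential equation for $t>0$. $A\lesssim_sB$ (resp. $\lesssim_{s,\varepsilon}$) means $A\le CB$ with a constant $C>0$ that may depend on $s$ (resp. on $s,\varepsilon$) and on the fixed parameters $\alpha,\lambda,\nu$ and the solution, but not on $t$. *)

theory Defs
  imports "HOL-Analysis.Analysis"
begin

text \<open>Sequences indexed by \<open>k \<ge> 1\<close> are functions \<open>nat \<Rightarrow> real\<close>. The entry at \<open>0\<close> does not
  enter the space or its norm, hence \<open>Suc k\<close> below; it only carries the convention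
  \<open>X\<^sub>0 = 0\<close> of the system.\<close>

definition N :: "real \<Rightarrow> nat \<Rightarrow> real" where
  "N lam k = lam ^ k"

definition Hs :: "real \<Rightarrow> real \<Rightarrow> (nat \<Rightarrow> real) set" where
  "Hs lam s = {x. summable (\<lambda>k. N lam (Suc k) powr (2 * s) * (x (Suc k))\<^sup>2)}"

text \<open>Meaningful only on \<^term>\<open>Hs lam s\<close>, since \<^const>\<open>suminf\<close> of a divergent series is
  unspecified.\<close>

definition Hs_norm :: "real \<Rightarrow> real \<Rightarrow> (nat \<Rightarrow> real) \<Rightarrow> real" where
  "Hs_norm lam s x = sqrt (\<Sum>k. N lam (Suc k) powr (2 * s) * (x (Suc k))\<^sup>2)"

abbreviation ell2_norm :: "real \<Rightarrow> (nat \<Rightarrow> real) \<Rightarrow> real" where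
  "ell2_norm lam x \<equiv> Hs_norm lam 0 x"

definition continuous_on_Hs :: "real \<Rightarrow> real \<Rightarrow> real set \<Rightarrow> (real \<Rightarrow> nat \<Rightarrow> real) \<Rightarrow> bool" where
  "continuous_on_Hs lam s I X \<longleftrightarrow>
     (\<forall>t\<in>I. X t \<in> Hs lam s) \<and>
     (\<forall>t\<in>I. ((\<lambda>u. Hs_norm lam s (\<lambda>k. X u k - X t k)) \<longlongrightarrow> 0) (at t within I))"

definition is_solution :: "real \<Rightarrow> real \<Rightarrow> real \<Rightarrow> (real \<Rightarrow> nat \<Rightarrow> real) \<Rightarrow> bool" where
  "is_solution \<nu> \<alpha> lam X \<longleftrightarrow>
     (\<forall>t>0. X t 0 = 0) \<and>
     (\<forall>k\<ge>1. continuous_on {0<..} (\<lambda>t. X t k) \<and>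
       (\<forall>t>0. ((\<lambda>t. X t k) has_real_derivative
          (- \<nu> * (N lam k)\<^sup>2 * X t k
           + N lam k powr \<alpha> * (X t (k + 1))\<^sup>2
           - N lam (k - 1) powr \<alpha> * X t (k - 1) * X t k)) (at t)))"

end

theory Submission
  imports Defs "HOL-Complex_Analysis.Great_Picard"
begin

text \<open>The nonlinearity conserves energy and moves it from shell \<open>k + 1\<close> to shell \<open>k\<close>. Start the system
  truncated to shells \<open>1, \<dots>, n\<close> with unit energy in shell \<open>n\<close>; all components stay nonnegative. The energy
  \<open>E\<^sub>k\<close> of the shells \<open>\<ge> k\<close> satisfies
  \<open>E\<^sub>k' \<le> - 2 \<nu> N\<^sub>k\<^sup>2 E\<^sub>k - 2 N\<^bsub>k-1\<^esub>\<^sup>\<alpha> X\<^bsub>k-1\<^esub> X\<^sub>k\<^sup>2\<close>. The first term gives \<open>E\<^sub>k \<le> exp (- 2 \<nu> N\<^sub>k\<^sup>2 t)\<close>,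
  hence all \<open>H\<^sup>s\<close> regularity at positive times. The second gives the decay
  \<open>E\<^sub>k \<lesssim> (N\<^sub>k\<^sup>\<alpha> t)\<^bsup>-(1+\<gamma>)\<^esup>\<close>, uniformly in \<open>n\<close>, whenever \<open>X\<^sub>j \<lesssim> (N\<^sub>j\<^sup>\<alpha> t)\<^bsup>-\<gamma>\<^esup>\<close> is known. Starting from \<open>\<gamma> = 0\<close>
  and iterating \<open>\<gamma> \<mapsto> (1 + \<gamma>) / 2\<close> one reaches every exponent below \<open>2\<close> for \<open>E\<^sub>k\<close>. The case \<open>\<gamma> = 0\<close> with
  \<open>\<alpha> > 2\<close> bounds the dissipation on \<open>(0, t)\<close> by a positive power of \<open>t\<close>, so no energy is lost in the limit
  \<open>n \<rightarrow> \<infinity>\<close> at time \<open>0+\<close>; the exponents near \<open>2\<close> give the upper bound for \<open>s < \<alpha>\<close>. Finally \<open>X\<^sub>k \<le> N\<^sub>k\<^sup>\<alpha> t\<close>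
  forces every component to \<open>0\<close> and most of the energy into shells with \<open>N\<^sub>k \<gtrsim> t\<^bsup>-1/\<alpha>\<^esup>\<close>, which is the lower
  bound.\<close>

subsection \<open>Global solutions of Lipschitz equations\<close>

text \<open>The library's completeness instance for bounded continuous functions asks for a metric domain; with
  this metric on \<^typ>\<open>nat\<close> it covers bounded sequences.\<close>

instantiation nat :: metric_space
begin

definition dist_nat :: "nat \<Rightarrow> nat \<Rightarrow> real" where "dist_nat m n = \<bar>real m - real n\<bar>"

definition uniformity_nat :: "(nat \<times> nat) filter"
  where "uniformity_nat = (INF e\<in>{0<..}. principal {(m, n). dist m n < e})"

instance
proof
  fix U :: "nat set"
  have "eventually (\<lambda>(m, n). m = k \<longrightarrow> n \<in> U) uniformity" if "k \<in> U" for k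
  proof -
    have "eventually (\<lambda>(m, n). m = k \<longrightarrow> n \<in> U) (principal {(m, n). dist m n < 1})"
    proof -
      have "j = k" if "dist k j < 1" for j
      proof -
        have "real k < real (Suc j)" "real j < real (Suc k)" using that by (auto simp: dist_nat_def)
        then show ?thesis by simp
      qed
      then show ?thesis using that by (auto simp: eventually_principal)
    qed
    then show ?thesis
      unfolding uniformity_nat_def by (rule eventually_INF1[rotated]) simp
  qed
  then show "open U \<longleftrightarrow> (\<forall>k\<in>U. \<forall>\<^sub>F (m, n) in uniformity. m = k \<longrightarrow> n \<in> U)"
    by (simp add: open_discrete)
qed (auto simp: dist_nat_def uniformity_nat_def)

end

instance bcontfun :: (metric_space, banach) banach ..

text \<open>The weight \<open>exp (- M t)\<close> with \<open>M\<close> above the Lipschitz constant makes the Picard map a contraction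
  on the whole half-line at once.\<close>

lemma lipschitz_ode_global:
  fixes F :: "'a::banach \<Rightarrow> 'a"
  assumes lip: "L-lipschitz_on UNIV F"
  obtains x where "x 0 = x0" "\<And>t. t \<ge> 0 \<Longrightarrow> (x has_vector_derivative F (x t)) (at t within {0..})"
proof -
  have L: "L \<ge> 0" using lip by (rule lipschitz_on_nonneg)
  have F: "norm (F u - F v) \<le> L * norm (u - v)" for u v
    using lipschitz_onD[OF lip, of u v] by (simp add: dist_norm)
  have contF: "continuous_on UNIV F" using lip by (rule lipschitz_on_continuous_on)
  define M where "M = L + 1"
  have M: "M > 0" "L < M" using L by (auto simp: M_def)
  \<comment> \<open>The fixed point is sought for the rescaled unknown
    \<open>y s = exp (- M * s) *\<^sub>R x s\<close>, so \<open>g y\<close> is \<open>F\<close>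
    along the unscaled trajectory.\<close>
  define g where "g y s = F (exp (M * s) *\<^sub>R apply_bcontfun y s)" for y :: "real \<Rightarrow>\<^sub>C 'a" and s
  have contg: "continuous_on S (g y)" for S y
    unfolding g_def by (rule continuous_on_compose2[OF contF]) (auto intro!: continuous_intros)
  have intg: "g y integrable_on {a..b}" for a b y
    by (rule integrable_continuous_interval[OF contg])
  define h where "h y t = x0 + integral {0..t} (g y)" for y t
  have conth: "continuous_on {0..} (h y)" for y
  proof -
    have "continuous_on {0..b} (h y)" for b
      unfolding h_def by (intro continuous_intros indefinite_integral_continuous_1 intg)
    then have "continuous (at t within {0..}) (h y)" if "t \<ge> 0" for t
    proof -
      have "continuous (at t within {0..t+1}) (h y)"
        using \<open>\<And>b. continuous_on {0..b} (h y)\<close>[of "t+1"] that by (simp add: continuous_on_eq_continuous_within)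
      moreover have "at t within {0..} = at t within {0..t+1}"
        by (rule at_within_nhd[of _ "{..<t+1}"]) auto
      ultimately show ?thesis by simp
    qed
    then show ?thesis by (simp add: continuous_on_eq_continuous_within)
  qed
  have int_exp: "((\<lambda>s. c * exp (M * s)) has_integral (c / M * (exp (M * t) - 1))) {0..t}" if "t \<ge> 0" for t c
  proof -
    have "((\<lambda>s. c * exp (M * s)) has_integral (c / M * exp (M * t) - c / M * exp (M * 0))) {0..t}"
      using that M by (intro fundamental_theorem_of_calculus)
        (auto intro!: derivative_eq_intros simp: has_real_derivative_iff_has_vector_derivative[symmetric])
    then show ?thesis by (simp add: algebra_simps)
  qed
  have int_bound: "norm (integral {0..t} f) \<le> c / M * exp (M * t)"
    if "t \<ge> 0" "f integrable_on {0..t}" "c \<ge> 0" "\<And>s. s \<in> {0..t} \<Longrightarrow> norm (f s) \<le> c * exp (M * s)" for t c and f :: "real \<Rightarrow> 'a"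
  proof -
    have "norm (integral {0..t} f) \<le> integral {0..t} (\<lambda>s. c * exp (M * s))"
      by (rule integral_norm_bound_integral) (use that int_exp[OF that(1)] in auto)
    also have "\<dots> = c / M * (exp (M * t) - 1)"
      using int_exp[OF that(1)] by (rule integral_unique)
    also have "\<dots> \<le> c / M * exp (M * t)" using M that by (intro mult_left_mono) auto
    finally show ?thesis .
  qed
  \<comment> \<open>Bounded continuous functions here live on the whole line; \<open>max 0 t\<close>
    freezes the Picard map at negative times.\<close>
  define P where "P y t = exp (- M * max 0 t) *\<^sub>R h y (max 0 t)" for y t
  have P_bcont: "P y \<in> bcontfun" for y
  proof (rule bcontfun_normI)
    show "continuous_on UNIV (P y)"
      unfolding P_def
      by (intro continuous_intros continuous_on_compose2[OF conth]) auto
    fix t :: real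
    define u where "u = max 0 t"
    have u: "u \<ge> 0" by (simp add: u_def)
    have "norm (integral {0..u} (g y)) \<le> (norm (F 0) + L * norm y) / M * exp (M * u)"
    proof (rule int_bound[OF u intg])
      fix s assume s: "s \<in> {0..u}"
      have "norm (g y s) \<le> norm (F 0) + norm (F (exp (M * s) *\<^sub>R apply_bcontfun y s) - F 0)"
        unfolding g_def using norm_triangle_sub by blast
      also have "\<dots> \<le> norm (F 0) * exp (M * s) + L * (exp (M * s) * norm y)"
      proof (intro add_mono)
        show "norm (F 0) \<le> norm (F 0) * exp (M * s)"
          using s M by (simp add: mult_le_cancel_left1)
        have "norm (F (exp (M * s) *\<^sub>R apply_bcontfun y s) - F 0) \<le> L * (exp (M * s) * norm (apply_bcontfun y s))"
          using F[of "exp (M * s) *\<^sub>R apply_bcontfun y s" 0] by simp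
        also have "\<dots> \<le> L * (exp (M * s) * norm y)"
          using L by (intro mult_left_mono norm_bounded) auto
        finally show "norm (F (exp (M * s) *\<^sub>R apply_bcontfun y s) - F 0) \<le> L * (exp (M * s) * norm y)" .
      qed
      finally show "norm (g y s) \<le> (norm (F 0) + L * norm y) * exp (M * s)" by (simp add: algebra_simps)
    qed (use L in auto)
    then have "norm (h y u) \<le> norm x0 + (norm (F 0) + L * norm y) / M * exp (M * u)"
      unfolding h_def by (intro norm_triangle_le) simp
    also have "\<dots> \<le> norm x0 * exp (M * u) + (norm (F 0) + L * norm y) / M * exp (M * u)"
      using u M by (simp add: mult_le_cancel_left1)
    finally have "exp (- M * u) * norm (h y u) \<le> exp (- M * u) * ((norm x0 + (norm (F 0) + L * norm y) / M) * exp (M * u))"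
      by (intro mult_left_mono) (auto simp: algebra_simps)
    also have "\<dots> = (norm x0 + (norm (F 0) + L * norm y) / M)" by (simp add: exp_minus field_simps)
    finally show "norm (P y t) \<le> norm x0 + (norm (F 0) + L * norm y) / M"
      by (simp add: P_def u_def)
  qed
  define Q where "Q y = Bcontfun (P y)" for y
  have Q: "apply_bcontfun (Q y) = P y" for y
    unfolding Q_def by (rule Bcontfun_inverse[OF P_bcont])
  \<comment> \<open>Integrating \<open>exp (M * s)\<close> produces a factor \<open>1 / M\<close>
    relative to the weight, hence the contraction factor \<open>L / M < 1\<close>.\<close>
  have "dist (Q y) (Q z) \<le> L / M * dist y z" for y z
  proof (rule dist_bound)
    fix t :: real
    define u where "u = max 0 t"
    have u: "u \<ge> 0" by (simp add: u_def)
    have "norm (integral {0..u} (\<lambda>s. g y s - g z s)) \<le> (L * dist y z) / M * exp (M * u)"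
    proof (rule int_bound[OF u])
      fix s assume s: "s \<in> {0..u}"
      have "norm (g y s - g z s) \<le> L * (exp (M * s) * norm (apply_bcontfun y s - apply_bcontfun z s))"
        unfolding g_def using F[of "exp (M * s) *\<^sub>R apply_bcontfun y s" "exp (M * s) *\<^sub>R apply_bcontfun z s"]
        by (simp flip: scaleR_diff_right)
      also have "\<dots> \<le> L * (exp (M * s) * dist y z)"
        using L by (intro mult_left_mono) (auto simp: dist_bounded simp flip: dist_norm)
      finally show "norm (g y s - g z s) \<le> (L * dist y z) * exp (M * s)" by (simp add: algebra_simps)
    qed (use L in \<open>auto intro!: integrable_diff intg\<close>)
    then have le: "norm (h y u - h z u) \<le> (L * dist y z) / M * exp (M * u)"
      unfolding h_def by (simp add: integral_diff intg)
    have "dist (P y t) (P z t) = exp (- M * u) * norm (h y u - h z u)"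
      by (simp add: P_def u_def dist_norm flip: scaleR_diff_right)
    also have "\<dots> \<le> exp (- M * u) * ((L * dist y z) / M * exp (M * u))"
      by (intro mult_left_mono le) auto
    also have "\<dots> = L / M * dist y z" by (simp add: exp_minus field_simps)
    finally show "dist (apply_bcontfun (Q y) t) (apply_bcontfun (Q z) t) \<le> L / M * dist y z" by (simp add: Q)
  qed
  then have "\<exists>!y. Q y = y"
    using L M by (intro banach_fix_type[of "L / M"]) auto
  then obtain y where y: "Q y = y" by blast
  define x where "x t = exp (M * t) *\<^sub>R apply_bcontfun y t" for t
  have x_eq: "x t = h y t" if "t \<ge> 0" for t
  proof -
    have "apply_bcontfun y t = P y t" using Q[of y] y by simp
    then show ?thesis using that by (simp add: x_def P_def flip: exp_add)
  qed
  show ?thesis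
  proof (rule that[of x])
    show "x 0 = x0" using x_eq[of 0] by (simp add: h_def)
    fix t :: real assume t: "t \<ge> 0"
    have "((\<lambda>u. integral {0..u} (g y)) has_vector_derivative g y t) (at t within {0..t+1})"
      by (rule integral_has_vector_derivative[OF contg]) (use t in auto)
    then have "(h y has_vector_derivative F (x t)) (at t within {0..t+1})"
      unfolding h_def g_def x_def by (auto intro!: derivative_eq_intros)
    moreover have "at t within {0..} = at t within {0..t+1}"
      by (rule at_within_nhd[of _ "{..<t+1}"]) auto
    ultimately have "(h y has_vector_derivative F (x t)) (at t within {0..})" by simp
    then show "(x has_vector_derivative F (x t)) (at t within {0..})"
      by (rule has_vector_derivative_transform[rotated 2]) (use t x_eq in auto)
  qed
qed


lemma at_within_atLeast_pos: "0 < t \<Longrightarrow> at t within {0..} = at (t::real)"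
  by (rule at_within_interior) simp

text \<open>If \<open>f t < 0\<close>, take the last time \<open>s\<close> before \<open>t\<close>
  with \<open>f s \<ge> 0\<close>. On \<open>(s, t)\<close> the function is negative, hence
  nondecreasing, so \<open>f t \<ge> f s \<ge> 0\<close>, a contradiction.\<close>

lemma nonneg_of_deriv_nonneg_below:
  fixes f f' :: "real \<Rightarrow> real"
  assumes der: "\<And>t. t \<ge> 0 \<Longrightarrow> (f has_real_derivative f' t) (at t within {0..})"
    and "f 0 \<ge> 0" and below: "\<And>t. t \<ge> 0 \<Longrightarrow> f t < 0 \<Longrightarrow> f' t \<ge> 0" and t: "t \<ge> 0"
  shows "f t \<ge> 0"
proof (rule ccontr)
  assume neg: "\<not> f t \<ge> 0"
  have cont: "continuous_on {0..} f"
    using DERIV_continuous[OF der] by (simp add: continuous_on_eq_continuous_within)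
  define S where "S = {0..t} \<inter> f -` {0..}"
  have "closed S"
    unfolding S_def by (rule continuous_closed_preimage[OF continuous_on_subset[OF cont]]) auto
  moreover have "bounded S"
    unfolding S_def by (rule bounded_subset[OF bounded_closed_interval]) auto
  ultimately have "compact S" by (simp add: compact_eq_bounded_closed)
  moreover have "0 \<in> S" using t \<open>f 0 \<ge> 0\<close> by (auto simp: S_def)
  ultimately obtain s where s: "s \<in> S" "\<And>u. u \<in> S \<Longrightarrow> u \<le> s"
    using compact_attains_sup[of S] by (metis empty_iff)
  have "s \<ge> 0" "s \<le> t" "f s \<ge> 0" using s by (auto simp: S_def)
  have "f s \<le> f t"
  proof (rule DERIV_nonneg_imp_increasing_open[OF \<open>s \<le> t\<close>])
    fix u assume u: "s < u" "u < t"
    have "u \<notin> S" using s(2)[of u] u by linarith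
    then have "f u < 0" using u \<open>s \<ge> 0\<close> by (simp add: S_def)
    moreover have "(f has_real_derivative f' u) (at u)"
      using der[of u] u \<open>s \<ge> 0\<close> by (simp add: at_within_atLeast_pos)
    ultimately show "\<exists>y. (f has_real_derivative y) (at u) \<and> 0 \<le> y"
      using below[of u] u \<open>s \<ge> 0\<close> by auto
  qed (use \<open>s \<ge> 0\<close> in \<open>auto intro: continuous_on_subset[OF cont]\<close>)
  then show False using neg \<open>f s \<ge> 0\<close> by simp
qed

subsection \<open>Truncated systems\<close>

definition clip :: "real \<Rightarrow> real" where "clip x = max 0 (min 1 x)"

lemma clip_range: "0 \<le> clip x" "clip x \<le> 1" "\<bar>clip x\<bar> \<le> 1"
  by (auto simp: clip_def)

lemma clip_lipschitz: "\<bar>clip x - clip y\<bar> \<le> \<bar>x - y\<bar>"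
  by (auto simp: clip_def min_def max_def)

lemma clip_mult_lipschitz: "\<bar>clip u * clip v - clip u' * clip v'\<bar> \<le> \<bar>u - u'\<bar> + \<bar>v - v'\<bar>"
proof -
  have "clip u * clip v - clip u' * clip v' = (clip u - clip u') * clip v + clip u' * (clip v - clip v')"
    by (simp add: algebra_simps)
  also have "\<bar>\<dots>\<bar> \<le> \<bar>clip u - clip u'\<bar> * 1 + 1 * \<bar>clip v - clip v'\<bar>"
    using clip_range by (intro abs_triangle_ineq[THEN order_trans] add_mono) (simp_all add: abs_mult mult_left_le mult_left_le_one_le)
  also have "\<dots> \<le> \<bar>u - u'\<bar> + \<bar>v - v'\<bar>"
    using clip_lipschitz[of u u'] clip_lipschitz[of v v'] by simp
  finally show ?thesis .
qed

text \<open>The clipped system is globally Lipschitz, and along it the sum of \<open>clip_prim\<close> over the shells is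
  nonincreasing by the same telescoping as for the energy, which keeps the components in \<open>[0, 1]\<close>, where
  clipping has no effect.\<close>

definition clip_prim :: "real \<Rightarrow> real" where "clip_prim x = x * clip x - (clip x)\<^sup>2 / 2"

text \<open>A quadratic bound on the remainder of the first-order expansion treats the kinks of
  \<open>clip\<close> at 0 and 1 together with all other points.\<close>

lemma clip_prim_deriv: "(clip_prim has_real_derivative clip x) (at x)"
proof -
  have bound: "\<bar>clip_prim y - clip_prim x - clip x * (y - x)\<bar> \<le> \<bar>y - x\<bar> * \<bar>y - x\<bar>" for y
  proof -
    have "clip_prim y - clip_prim x - clip x * (y - x) = (clip y - clip x) * (y - (clip x + clip y) / 2)"
      by (simp add: clip_prim_def power2_eq_square field_simps)
    also have "\<bar>\<dots>\<bar> \<le> \<bar>y - x\<bar> * \<bar>y - x\<bar>"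
    proof (cases "clip y = clip x")
      case False
      then have "\<bar>y - (clip x + clip y) / 2\<bar> \<le> \<bar>y - x\<bar>"
        by (auto simp: clip_def min_def max_def abs_if split: if_splits)
      then show ?thesis unfolding abs_mult by (intro mult_mono clip_lipschitz) auto
    qed simp
    finally show ?thesis .
  qed
  have "((\<lambda>y. (clip_prim y - clip_prim x) / (y - x) - clip x) \<longlongrightarrow> 0) (at x)"
  proof (rule Lim_null_comparison)
    show "\<forall>\<^sub>F y in at x. norm ((clip_prim y - clip_prim x) / (y - x) - clip x) \<le> \<bar>y - x\<bar>"
    proof (rule eventually_mono[OF eventually_neq_at_within[of x]])
      fix y assume "y \<noteq> x"
      then have "(clip_prim y - clip_prim x) / (y - x) - clip x = (clip_prim y - clip_prim x - clip x * (y - x)) / (y - x)"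
        by (simp add: field_simps)
      then show "norm ((clip_prim y - clip_prim x) / (y - x) - clip x) \<le> \<bar>y - x\<bar>"
        using bound[of y] \<open>y \<noteq> x\<close> by (simp add: divide_le_eq)
    qed
    show "((\<lambda>y. \<bar>y - x\<bar>) \<longlongrightarrow> 0) (at x)" by (auto intro!: tendsto_eq_intros)
  qed
  then show ?thesis unfolding has_field_derivative_iff by (simp add: LIM_zero_iff)
qed

text \<open>Damping \<open>d\<close> and coupling \<open>a\<close> stay abstract; they become
  \<open>\<nu> * lam ^ (2 * k)\<close> and \<open>lam powr (\<alpha> * k)\<close>. The equation is
  imposed only for \<open>k \<ge> 1\<close>, so natural subtraction in \<open>k - 1\<close> is
  genuine.\<close>

abbreviation shell_rhs :: "(nat \<Rightarrow> real) \<Rightarrow> (nat \<Rightarrow> real) \<Rightarrow> (nat \<Rightarrow> real) \<Rightarrow> nat \<Rightarrow> real" where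
  "shell_rhs d a y k \<equiv> - d k * y k + a k * (y (Suc k))\<^sup>2 - a (k - 1) * y (k - 1) * y k"

text \<open>By \<open>x_above\<close> shell \<open>n\<close> has no inflow, which closes the system
  of \<open>n\<close> equations. Nonnegativity is part of the interface because it fixes the sign of
  the flux between shells.\<close>

locale truncated =
  fixes d a :: "nat \<Rightarrow> real" and n :: nat and x :: "real \<Rightarrow> nat \<Rightarrow> real"
  assumes d_nonneg: "\<And>k. d k \<ge> 0" and a_nonneg: "\<And>k. a k \<ge> 0" and n_pos: "n \<ge> 1"
    and init: "\<And>k. x 0 k = (if k = n then 1 else 0)"
    and x_nonneg: "\<And>t k. t \<ge> 0 \<Longrightarrow> x t k \<ge> 0"
    and x_zero: "\<And>t. t \<ge> 0 \<Longrightarrow> x t 0 = 0"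
    and x_above: "\<And>t k. t \<ge> 0 \<Longrightarrow> k > n \<Longrightarrow> x t k = 0"
    and x_ode: "\<And>t k. t \<ge> 0 \<Longrightarrow> k \<in> {1..n} \<Longrightarrow>
      ((\<lambda>t. x t k) has_real_derivative shell_rhs d a (x t) k) (at t within {0..})"

lemma truncated_exists:
  fixes d a :: "nat \<Rightarrow> real"
  assumes d: "\<And>k. d k \<ge> 0" and a: "\<And>k. a k \<ge> 0" and n: "n \<ge> 1"
  shows "\<exists>x. truncated d a n x"
proof -
  \<comment> \<open>Only the quadratic terms are clipped; the linear damping is Lipschitz
    already.\<close>
  define f where "f y k = (if k \<in> {1..n}
      then - d k * y k + a k * (clip (y (Suc k)))\<^sup>2 - a (k - 1) * (clip (y (k - 1)) * clip (y k)) else 0)"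
    for y :: "nat \<Rightarrow> real" and k
  \<comment> \<open>Each clipped product changes by at most twice the sup distance of its arguments,
    whence the factors 2.\<close>
  define B where "B = Max ((\<lambda>k. d k + 2 * a k + 2 * a (k - 1)) ` {1..n})"
  have B: "d k + 2 * a k + 2 * a (k - 1) \<le> B" if "k \<in> {1..n}" for k
    unfolding B_def using that by (intro Max_ge) auto
  have B0: "B \<ge> 0" using B[of n] n d[of n] a[of n] a[of "n - 1"] by auto
  have f_lip: "\<bar>f y k - f z k\<bar> \<le> B * e" if e: "\<And>j. \<bar>y j - z j\<bar> \<le> e" for y z k e
  proof (cases "k \<in> {1..n}")
    case True
    have e0: "e \<ge> 0" using e[of 0] by linarith
    have abs3: "\<bar>- u + v - w\<bar> \<le> \<bar>u\<bar> + \<bar>v\<bar> + \<bar>w\<bar>" for u v w :: real by linarith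
    have eq: "f y k - f z k = - (d k * (y k - z k)) + a k * (clip (y (Suc k)) * clip (y (Suc k)) - clip (z (Suc k)) * clip (z (Suc k)))
        - a (k - 1) * (clip (y (k - 1)) * clip (y k) - clip (z (k - 1)) * clip (z k))"
      using True by (simp add: f_def algebra_simps power2_eq_square)
    have "\<bar>f y k - f z k\<bar> \<le> d k * \<bar>y k - z k\<bar> + a k * \<bar>clip (y (Suc k)) * clip (y (Suc k)) - clip (z (Suc k)) * clip (z (Suc k))\<bar>
        + a (k - 1) * \<bar>clip (y (k - 1)) * clip (y k) - clip (z (k - 1)) * clip (z k)\<bar>"
      unfolding eq
      using abs3[of "d k * (y k - z k)" "a k * (clip (y (Suc k)) * clip (y (Suc k)) - clip (z (Suc k)) * clip (z (Suc k)))"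
          "a (k - 1) * (clip (y (k - 1)) * clip (y k) - clip (z (k - 1)) * clip (z k))"]
      by (simp only: abs_mult abs_of_nonneg[OF d] abs_of_nonneg[OF a])
    also have "\<dots> \<le> d k * e + a k * (e + e) + a (k - 1) * (e + e)"
      by (intro add_mono mult_left_mono d a order_trans[OF clip_mult_lipschitz] e)
    also have "\<dots> = (d k + 2 * a k + 2 * a (k - 1)) * e" by (simp add: algebra_simps)
    also have "\<dots> \<le> B * e" by (intro mult_right_mono B True e0)
    finally show ?thesis .
  next
    case False
    have "f y k - f z k = 0" unfolding f_def if_not_P[OF False] by simp
    moreover have "0 \<le> B * e" using e[of 0] B0 by (intro mult_nonneg_nonneg) auto
    ultimately show ?thesis by simp
  qed
  have fin: "g \<in> bcontfun" if "\<And>k. k \<notin> {1..n} \<Longrightarrow> g k = (0::real)" for g :: "nat \<Rightarrow> real"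
  proof (rule bcontfun_normI)
    show "continuous_on UNIV g" by (simp add: continuous_on_open_vimage open_discrete)
    show "norm (g k) \<le> Max (insert 0 ((\<lambda>k. \<bar>g k\<bar>) ` {1..n}))" for k
    proof (rule Max_ge)
      show "norm (g k) \<in> insert 0 ((\<lambda>k. \<bar>g k\<bar>) ` {1..n})"
        using that[of k] by (cases "k \<in> {1..n}") force+
    qed simp
  qed
  define F :: "(nat \<Rightarrow>\<^sub>C real) \<Rightarrow> (nat \<Rightarrow>\<^sub>C real)" where "F y = Bcontfun (f (apply_bcontfun y))" for y
  have F: "apply_bcontfun (F y) = f (apply_bcontfun y)" for y
    unfolding F_def by (intro Bcontfun_inverse fin) (auto simp: f_def)
  have lip: "B-lipschitz_on UNIV F"
  proof (rule lipschitz_onI[OF _ B0])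
    fix y z :: "nat \<Rightarrow>\<^sub>C real"
    show "dist (F y) (F z) \<le> B * dist y z"
    proof (rule dist_bound)
      fix k
      have "\<bar>y j - z j\<bar> \<le> dist y z" for j
        using dist_bounded[of y j z] by (simp add: dist_real_def)
      then show "dist (F y k) (F z k) \<le> B * dist y z"
        unfolding F dist_real_def by (rule f_lip)
    qed
  qed
  define x0 :: "nat \<Rightarrow>\<^sub>C real" where "x0 = Bcontfun (\<lambda>k. if k = n then 1 else 0)"
  have x0: "x0 k = (if k = n then 1 else 0)" for k
    unfolding x0_def by (subst Bcontfun_inverse) (use n in \<open>auto intro!: fin\<close>)
  obtain X where X0: "X 0 = x0" and X: "\<And>t. t \<ge> 0 \<Longrightarrow> (X has_vector_derivative F (X t)) (at t within {0..})"
    using lipschitz_ode_global[OF lip] by blast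
  have bl: "bounded_linear (\<lambda>y::nat \<Rightarrow>\<^sub>C real. y k)" for k
    by (rule bounded_linear_intro[of _ 1]) (use norm_bounded[where 'b = real and x = k] in auto)
  have ode: "((\<lambda>t. X t k) has_real_derivative f (X t) k) (at t within {0..})" if "t \<ge> 0" for t k
    using bounded_linear.has_vector_derivative[OF bl X[OF that], of k]
    by (simp add: F has_real_derivative_iff_has_vector_derivative)
  have const: "X t k = x0 k" if "t \<ge> 0" "k \<notin> {1..n}" for t k
  proof -
    have "((\<lambda>t. X t k) has_real_derivative 0) (at t within {0..})" if "t \<in> {0..}" for t
      using ode[of t k] that unfolding f_def if_not_P[OF \<open>k \<notin> {1..n}\<close>] by simp
    then obtain c where "\<And>t. t \<in> {0..} \<Longrightarrow> X t k = c"
      using has_field_derivative_zero_constant[of "{0..}" "\<lambda>t. X t k"] by auto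
    then show ?thesis using that X0 by (metis atLeast_iff order_refl)
  qed
  \<comment> \<open>Where a component is negative its clip vanishes and with it the outflow; damping
    and inflow then push it upwards.\<close>
  have nonneg: "X t k \<ge> 0" if "t \<ge> 0" for t k
  proof (cases "k \<in> {1..n}")
    case True
    show ?thesis
    proof (rule nonneg_of_deriv_nonneg_below[OF ode _ _ that])
      show "X 0 k \<ge> 0" by (simp add: X0 x0)
      fix t :: real assume "t \<ge> 0" "X t k < 0"
      then have "clip (X t k) = 0" by (simp add: clip_def)
      moreover have "- d k * X t k \<ge> 0" using d[of k] \<open>X t k < 0\<close>
        by (simp add: mult_nonneg_nonpos)
      moreover have "0 \<le> a k * (clip (X t (Suc k)))\<^sup>2" using a[of k] by simp
      ultimately show "f (X t) k \<ge> 0"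
        using True unfolding f_def by simp
    qed
  next
    case False
    then show ?thesis using const[OF that, of k] x0 by simp
  qed
  define H where "H t = (\<Sum>k=1..n. clip_prim (X t k))" for t
  have H_deriv: "(H has_real_derivative - (\<Sum>k=1..n. d k * X t k * clip (X t k))) (at t within {0..})" if "t \<ge> 0" for t
  proof -
    \<comment> \<open>\<open>u k\<close> is the clipped flux from shell \<open>k + 1\<close> into
      shell \<open>k\<close>. It vanishes at both ends of the chain, so only damping changes
      \<open>H\<close>.\<close>
    define u where "u k = a k * clip (X t k) * (clip (X t (Suc k)))\<^sup>2" for k
    have "(H has_real_derivative (\<Sum>k=1..n. clip (X t k) * f (X t) k)) (at t within {0..})"
      unfolding H_def
      by (intro DERIV_sum DERIV_chain2[OF clip_prim_deriv] ode that)
    also have "(\<Sum>k=1..n. clip (X t k) * f (X t) k) = (\<Sum>k=1..n. (u k - u (k - 1)) - d k * X t k * clip (X t k))"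
    proof (rule sum.cong[OF refl])
      fix k assume k: "k \<in> {1..n}"
      then have "Suc (k - 1) = k" by auto
      then show "clip (X t k) * f (X t) k = (u k - u (k - 1)) - d k * X t k * clip (X t k)"
        using k by (simp add: f_def u_def algebra_simps power2_eq_square)
    qed
    also have "\<dots> = u n - u 0 - (\<Sum>k=1..n. d k * X t k * clip (X t k))"
      using sum_telescope''[of 0 n u] by (simp add: sum_subtractf)
    also have "u n = 0" using const[OF that, of "Suc n"] by (simp add: u_def x0 clip_def)
    also have "u 0 = 0" using const[OF that, of 0] n by (simp add: u_def x0 clip_def)
    finally show ?thesis by simp
  qed
  have X_le: "X t k \<le> 1" if t: "t \<ge> 0" for t k
  proof (cases "k \<in> {1..n}")
    case True
    have prim: "clip_prim y \<ge> 0" if "y \<ge> 0" for y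
      using that by (auto simp: clip_prim_def clip_def min_def max_def power2_eq_square mult_nonneg_nonneg)
    have "H t \<le> H 0"
    proof (rule DERIV_nonpos_imp_decreasing_open[OF t])
      fix s assume s: "0 < s" "s < t"
      have "0 \<le> (\<Sum>k=1..n. d k * X s k * clip (X s k))"
        using s by (intro sum_nonneg mult_nonneg_nonneg d nonneg clip_range) auto
      then show "\<exists>y. (H has_real_derivative y) (at s) \<and> y \<le> 0"
        using H_deriv[of s] s by (auto simp: at_within_atLeast_pos)
    next
      show "continuous_on {0..t} H"
        using DERIV_continuous[OF H_deriv, THEN continuous_within_subset, of _ "{0..t}"]
        by (simp add: continuous_on_eq_continuous_within)
    qed
    also have "H 0 = (\<Sum>k=1..n. if k = n then 1 / 2 else 0)"
      unfolding H_def X0 x0 by (intro sum.cong) (auto simp: clip_prim_def clip_def)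
    also have "\<dots> = 1 / 2" using n by (simp add: sum.delta)
    also have "clip_prim (X t k) \<le> H t"
      unfolding H_def using True t by (intro member_le_sum prim nonneg) auto
    \<comment> \<open>On nonnegative arguments \<open>clip_prim y\<close> is
      \<open>y\<^sup>2 / 2\<close> up to 1 and \<open>y - 1 / 2\<close> beyond, so the value 1/2 is
      not exceeded exactly when \<open>y \<le> 1\<close>.\<close>
    ultimately have "clip_prim (X t k) \<le> 1 / 2" by linarith
    then show ?thesis
      by (auto simp: clip_prim_def clip_def min_def max_def power2_eq_square split: if_splits)
  next
    case False
    then show ?thesis using const[OF t, of k] x0 by simp
  qed
  have clip_X: "clip (X t k) = X t k" if "t \<ge> 0" for t k
    using nonneg[OF that, of k] X_le[OF that, of k] by (simp add: clip_def)
  have "truncated d a n (\<lambda>t k. X t k)"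
  proof
    fix t :: real and k assume t: "t \<ge> 0"
    show "X t k \<ge> 0" by (rule nonneg[OF t])
    show "X t 0 = 0" using const[OF t, of 0] n by (simp add: x0)
    show "k > n \<Longrightarrow> X t k = 0" using const[OF t, of k] by (simp add: x0)
    show "((\<lambda>t. X t k) has_real_derivative shell_rhs d a (\<lambda>k. X t k) k) (at t within {0..})"
      if "k \<in> {1..n}"
      using ode[OF t, of k] that clip_X[OF t] by (simp add: f_def mult.assoc)
  qed (use d a n in \<open>auto simp: X0 x0\<close>)
  then show ?thesis by blast
qed

section \<open>Energy estimates for the truncated systems\<close>

context truncated
begin

definition energy :: "nat \<Rightarrow> real \<Rightarrow> real" where "energy k t = (\<Sum>j=k..n. (x t j)\<^sup>2)"

lemma x_cont: "continuous_on {0..} (\<lambda>t. x t k)"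
proof (cases "k \<in> {1..n}")
  case True
  then show ?thesis
    using DERIV_continuous[OF x_ode] by (simp add: continuous_on_eq_continuous_within)
next
  case False
  then have "k = 0 \<or> k > n" by auto
  then have "x t k = 0" if "t \<ge> 0" for t using x_zero x_above that by auto
  then have "continuous_on {0..} (\<lambda>t. x t k) \<longleftrightarrow> continuous_on {0..} (\<lambda>t::real. 0::real)"
    by (intro continuous_on_cong) auto
  then show ?thesis by simp
qed

lemma energy_cont: "continuous_on {0..} (energy k)"
  unfolding energy_def by (intro continuous_intros x_cont)

lemma energy_nonneg: "energy k t \<ge> 0"
  by (simp add: energy_def sum_nonneg)

lemma energy_above: "k > n \<Longrightarrow> energy k t = 0"
  by (simp add: energy_def)

lemma energy_Suc: "t \<ge> 0 \<Longrightarrow> energy k t = (x t k)\<^sup>2 + energy (Suc k) t"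
  by (cases "k \<le> n") (simp_all add: energy_def sum.atLeast_Suc_atMost x_above)

lemma sq_le_energy: "t \<ge> 0 \<Longrightarrow> (x t k)\<^sup>2 \<le> energy k t"
  by (simp add: energy_Suc[of t k] energy_nonneg)

lemma energy_split:
  assumes "t \<ge> 0"
  shows "energy 1 t = (\<Sum>j=1..m. (x t j)\<^sup>2) + energy (Suc m) t"
proof (induction m)
  case (Suc m)
  then show ?case using energy_Suc[OF assms, of "Suc m"] by simp
qed simp

text \<open>The quadratic terms telescope. No flux enters at the top because shell
  \<open>n + 1\<close> is empty, so besides damping only the flux from shell \<open>k\<close> down
  to shell \<open>k - 1\<close> remains.\<close>

lemma energy_deriv:
  assumes t: "t \<ge> 0" and k: "k \<ge> 1"
  shows "(energy k has_real_derivative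
    - 2 * (\<Sum>j=k..n. d j * (x t j)\<^sup>2) - 2 * a (k - 1) * x t (k - 1) * (x t k)\<^sup>2) (at t within {0..})"
proof (cases "k \<le> n")
  case True
  define u where "u j = 2 * a j * x t j * (x t (Suc j))\<^sup>2" for j
  let ?rhs = "shell_rhs d a (x t)"
  have "(energy k has_real_derivative (\<Sum>j=k..n. 2 * x t j * ?rhs j)) (at t within {0..})"
    unfolding energy_def
  proof (rule DERIV_sum)
    fix j assume "j \<in> {k..n}"
    then have "((\<lambda>t. x t j) has_real_derivative ?rhs j) (at t within {0..})"
      using k t by (intro x_ode) auto
    from DERIV_power[OF this, of 2]
    show "((\<lambda>t. (x t j)\<^sup>2) has_real_derivative 2 * x t j * ?rhs j) (at t within {0..})"
      by (simp add: mult_ac)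
  qed
  also have "(\<Sum>j=k..n. 2 * x t j * ?rhs j) = (\<Sum>j=k..n. (u j - u (j - 1)) - 2 * (d j * (x t j)\<^sup>2))"
  proof (rule sum.cong[OF refl])
    fix j assume "j \<in> {k..n}"
    then have "Suc (j - 1) = j" using k by auto
    then show "2 * x t j * ?rhs j = (u j - u (j - 1)) - 2 * (d j * (x t j)\<^sup>2)"
      by (simp add: u_def algebra_simps power2_eq_square)
  qed
  also have "\<dots> = (\<Sum>j=Suc (k-1)..n. u j - u (j - 1)) - 2 * (\<Sum>j=k..n. d j * (x t j)\<^sup>2)"
    using k by (simp add: sum_subtractf sum_distrib_left)
  also have "(\<Sum>j=Suc (k-1)..n. u j - u (j - 1)) = u n - u (k - 1)"
    using True by (intro sum_telescope'') auto
  also have "u n = 0" using x_above[OF t, of "Suc n"] by (simp add: u_def)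
  also have "u (k - 1) = 2 * a (k - 1) * x t (k - 1) * (x t k)\<^sup>2" using k by (simp add: u_def)
  finally show ?thesis by (rule DERIV_cong) simp
next
  case False
  then have "energy k = (\<lambda>_. 0)" by (auto simp: energy_above)
  with False show ?thesis using x_above[OF t, of k] by simp
qed

lemma energy_decay:
  assumes t: "t \<ge> 0" and k: "k \<ge> 1" and d_mono: "\<And>j. j \<ge> k \<Longrightarrow> d k \<le> d j"
  shows "\<exists>D. (energy k has_real_derivative D) (at t within {0..})
    \<and> D \<le> - 2 * d k * energy k t - 2 * a (k - 1) * x t (k - 1) * (x t k)\<^sup>2"
proof -
  have "d k * energy k t \<le> (\<Sum>j=k..n. d j * (x t j)\<^sup>2)"
    unfolding energy_def sum_distrib_left by (intro sum_mono mult_right_mono d_mono) auto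
  then show ?thesis using energy_deriv[OF t k] by (intro exI conjI) auto
qed

lemma energy_antimono:
  assumes "0 \<le> s" "s \<le> t" and k: "k \<ge> 1"
  shows "energy k t \<le> energy k s"
proof (rule DERIV_nonpos_imp_decreasing_open[OF \<open>s \<le> t\<close>])
  fix u assume u: "s < u" "u < t"
  then have "u > 0" using \<open>0 \<le> s\<close> by simp
  moreover have "0 \<le> (\<Sum>j=k..n. d j * (x u j)\<^sup>2)"
    by (intro sum_nonneg mult_nonneg_nonneg d_nonneg) auto
  moreover have "0 \<le> a (k - 1) * x u (k - 1) * (x u k)\<^sup>2"
    using \<open>u > 0\<close> by (intro mult_nonneg_nonneg a_nonneg x_nonneg) auto
  ultimately show "\<exists>y. (energy k has_real_derivative y) (at u) \<and> y \<le> 0"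
    using energy_deriv[of u k] k by (auto simp: at_within_atLeast_pos)
next
  show "continuous_on {s..t} (energy k)"
    by (rule continuous_on_subset[OF energy_cont]) (use \<open>0 \<le> s\<close> in auto)
qed

lemma energy_init: "energy k 0 = (if k \<le> n then 1 else 0)"
proof -
  have "energy k 0 = (\<Sum>j=k..n. if j = n then 1 else 0)"
    unfolding energy_def by (intro sum.cong) (auto simp: init)
  then show ?thesis by (simp add: sum.delta)
qed

lemma energy_le_1: "t \<ge> 0 \<Longrightarrow> k \<ge> 1 \<Longrightarrow> energy k t \<le> 1"
  using energy_antimono[of 0 t k] energy_init[of k] by (auto split: if_splits)

lemma x_le_1: "t \<ge> 0 \<Longrightarrow> x t k \<le> 1"
proof (cases "k = 0")
  case False
  assume "t \<ge> 0"
  then have "(x t k)\<^sup>2 \<le> 1" using sq_le_energy[of t k] energy_le_1[of t k] False by simp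
  then show ?thesis by (simp add: abs_square_le_1)
qed (simp add: x_zero)

text \<open>The outgoing flux only helps and is dropped; \<open>exp (2 * d k * t)\<close> is the
  integrating factor for the damping.\<close>

lemma energy_exp_decay:
  assumes t: "t \<ge> 0" and k: "k \<ge> 1" and d_mono: "\<And>j. j \<ge> k \<Longrightarrow> d k \<le> d j"
  shows "energy k t \<le> exp (- 2 * d k * t)"
proof -
  define h where "h t = energy k t * exp (2 * d k * t)" for t
  have "h t \<le> h 0"
  proof (rule DERIV_nonpos_imp_decreasing_open[OF t])
    fix u assume u: "0 < u" "u < t"
    obtain D where D: "(energy k has_real_derivative D) (at u)"
      "D \<le> - 2 * d k * energy k u - 2 * a (k - 1) * x u (k - 1) * (x u k)\<^sup>2"
      using energy_decay[OF _ k d_mono, of u] u by (auto simp: at_within_atLeast_pos)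
    have "0 \<le> a (k - 1) * x u (k - 1) * (x u k)\<^sup>2"
      using u by (intro mult_nonneg_nonneg a_nonneg x_nonneg) auto
    then have "D + 2 * d k * energy k u \<le> 0" using D(2) by simp
    then have "(D + 2 * d k * energy k u) * exp (2 * d k * u) \<le> 0"
      by (simp add: mult_nonpos_nonneg)
    moreover have "(h has_real_derivative (D + 2 * d k * energy k u) * exp (2 * d k * u)) (at u)"
      unfolding h_def by (auto intro!: derivative_eq_intros D(1) simp: algebra_simps)
    ultimately show "\<exists>y. (h has_real_derivative y) (at u) \<and> y \<le> 0" by blast
  next
    show "continuous_on {0..t} h"
      unfolding h_def by (intro continuous_intros continuous_on_subset[OF energy_cont]) auto
  qed
  also have "h 0 \<le> 1" by (simp add: h_def energy_init)
  finally show ?thesis by (simp add: h_def exp_minus field_simps)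
qed

text \<open>A shell below \<open>n\<close> starts at 0, and its only gain is the inflow, at most
  \<open>a k\<close> since \<open>x t (Suc k) \<le> 1\<close>.\<close>

lemma x_linear_growth:
  assumes t: "t \<ge> 0" and "k < n"
  shows "x t k \<le> a k * t"
proof (cases "k = 0")
  case True
  then show ?thesis using t a_nonneg[of k] by (simp add: x_zero)
next
  case False
  have "a k * 0 - x 0 k \<le> a k * t - x t k"
  proof (rule DERIV_nonneg_imp_increasing_open[OF t])
    fix u assume u: "0 < u" "u < t"
    have "(x u (Suc k))\<^sup>2 \<le> 1" using u x_nonneg[of u "Suc k"] x_le_1[of u "Suc k"]
      by (simp add: abs_square_le_1)
    then have "a k * (x u (Suc k))\<^sup>2 \<le> a k" using a_nonneg[of k] by (simp add: mult_left_le)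
    moreover have "0 \<le> d k * x u k" "0 \<le> a (k - 1) * x u (k - 1) * x u k"
      using u by (auto intro!: mult_nonneg_nonneg a_nonneg d_nonneg x_nonneg)
    ultimately have "0 \<le> a k * 1 - shell_rhs d a (x u) k"
      by linarith
    moreover have "((\<lambda>t. a k * t - x t k) has_real_derivative a k * 1 - shell_rhs d a (x u) k) (at u)"
      using x_ode[of u k] u \<open>k < n\<close> False
      by (intro derivative_intros DERIV_cmult DERIV_ident) (auto simp: at_within_atLeast_pos)
    ultimately show "\<exists>y. ((\<lambda>t. a k * t - x t k) has_real_derivative y) (at u) \<and> 0 \<le> y"
      by blast
  next
    show "continuous_on {0..t} (\<lambda>t. a k * t - x t k)"
      by (intro continuous_intros continuous_on_subset[OF x_cont]) auto
  qed
  then show ?thesis using init[of k] \<open>k < n\<close> by simp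
qed

lemma abs_rhs_le:
  assumes u: "u \<ge> 0"
  shows "\<bar>shell_rhs d a (x u) k\<bar> \<le> d k + a k + a (k - 1)"
proof -
  have "d k * x u k \<le> d k * 1" "a k * (x u (Suc k))\<^sup>2 \<le> a k * 1"
    "a (k - 1) * (x u (k - 1) * x u k) \<le> a (k - 1) * 1"
    by (intro mult_left_mono d_nonneg a_nonneg mult_le_one power_le_one x_le_1[OF u] x_nonneg[OF u])+
  moreover have "0 \<le> d k * x u k" "0 \<le> a k * (x u (Suc k))\<^sup>2" "0 \<le> a (k - 1) * (x u (k - 1) * x u k)"
    using x_nonneg[OF u] by (auto intro!: mult_nonneg_nonneg d_nonneg a_nonneg)
  ultimately show ?thesis
    using d_nonneg[of k] a_nonneg[of k] a_nonneg[of "k - 1"]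
    unfolding abs_le_iff mult.assoc by linarith
qed

text \<open>The constant depends on the shell but not on \<open>n\<close>: this is the
  equicontinuity behind the passage to the limit.\<close>

lemma x_lipschitz:
  assumes "s \<ge> 0" "t \<ge> 0"
  shows "\<bar>x t k - x s k\<bar> \<le> (d k + a k + a (k - 1)) * \<bar>t - s\<bar>"
proof (cases "k \<in> {1..n}")
  case True
  have "norm (x t k - x s k) \<le> (d k + a k + a (k - 1)) * norm (t - s)"
  proof (rule field_differentiable_bound[of "{0..}"])
    fix u :: real assume "u \<in> {0..}"
    then have u: "u \<ge> 0" by simp
    show "((\<lambda>t. x t k) has_real_derivative shell_rhs d a (x u) k) (at u within {0..})"
      by (rule x_ode[OF u True])
    show "norm (shell_rhs d a (x u) k) \<le> d k + a k + a (k - 1)"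
      using abs_rhs_le[OF u] by simp
  qed (use assms in auto)
  then show ?thesis by simp
next
  case False
  then have "x t k = 0" "x s k = 0" using assms x_zero x_above by (cases "k = 0"; simp)+
  then show ?thesis using d_nonneg[of k] a_nonneg[of k] a_nonneg[of "k - 1"] by simp
qed

end

subsection \<open>Uniform decay of the tail energy\<close>

text \<open>Let \<open>e\<close> be the value of the tail energy at the point \<open>t\<^sub>0\<close> where \<open>E\<^sub>k(t) t\<^bsup>1+\<gamma>\<^esup>\<close> is maximal. If the bound
  fails, then on \<open>[\<rho> t\<^sub>0, t\<^sub>0]\<close> the shells above \<open>k\<close> hold little of the energy, so
  \<open>X\<^sub>k\<^sup>2 \<ge> (1 - \<rho>) e\<close>, which feeds shell \<open>k - 1\<close>. The losses of shell \<open>k - 1\<close> are at most \<open>M\<close> times the rate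
  at which \<open>E\<^sub>k / e\<close> drains, and \<open>E\<^sub>k\<close> drains only by a bounded factor on that interval. Hence
  \<open>X\<^bsub>k-1\<^esub> - c M E\<^sub>k / e\<close> grows too much.\<close>

lemma (in truncated) tail_bound_descend:
  fixes q \<rho> \<gamma> T A B :: real
  assumes a_eq: "\<And>j. a j = q ^ j" and \<rho>: "0 < \<rho>" "\<rho> < 1" and q\<rho>: "\<rho>\<^sup>2 * q = 1"
    and d_mono: "\<And>i j. i \<le> j \<Longrightarrow> d i \<le> d j" and \<gamma>: "0 \<le> \<gamma>" "\<gamma> \<le> 1" and T: "T > 0" and B: "B \<ge> 0"
    and dec: "\<And>j t. 0 < t \<Longrightarrow> t \<le> T \<Longrightarrow> x t j \<le> B * (q ^ j * t) powr (- \<gamma>)"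
    and k: "k \<ge> 2"
    and IH: "\<And>t. 0 < t \<Longrightarrow> t \<le> T \<Longrightarrow> energy (Suc k) t \<le> A * (q ^ Suc k * t) powr (- (1 + \<gamma>))"
    and A: "B * (1 + q / (2 * (1 - \<rho>))) * q ^ 3 / (\<rho> * (1 - \<rho>)\<^sup>2) \<le> A"
    and t: "0 < t" "t \<le> T"
  shows "energy k t \<le> A * (q ^ k * t) powr (- (1 + \<gamma>))"
proof (rule ccontr)
  assume viol: "\<not> energy k t \<le> A * (q ^ k * t) powr (- (1 + \<gamma>))"
  define p where "p = 1 + \<gamma>"
  have p: "1 \<le> p" "p \<le> 2" using \<gamma> by (auto simp: p_def)
  have q_eq: "q = 1 / \<rho>\<^sup>2" using q\<rho> \<rho> by (simp add: field_simps)
  have q1: "q > 1" unfolding q_eq using \<rho> by (simp add: power_less_one_iff)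
  define c where "c = 1 / (2 * (1 - \<rho>))"
  have c: "c > 0" "2 * c \<ge> 1" "2 * c * (1 - \<rho>) = 1" using \<rho> by (auto simp: c_def field_simps)
  have A0: "A \<ge> 0"
    using \<rho> q1 B by (intro order_trans[OF _ A] divide_nonneg_nonneg mult_nonneg_nonneg add_nonneg_nonneg) auto
  define b where "b = A * (q ^ k) powr (- p)"
  have b0: "b \<ge> 0" using A0 by (simp add: b_def)
  have scale: "A * (q ^ k * s) powr (- p) = b / s powr p" if "s > 0" for s
    using that q1 by (simp add: b_def powr_mult powr_minus field_simps)
  define g where "g s = energy k s * s powr p" for s
  have "continuous_on {0..T} g"
    unfolding g_def using p by (intro continuous_intros continuous_on_powr' continuous_on_subset[OF energy_cont]) auto
  then obtain t0 where t0: "t0 \<in> {0..T}" "\<And>s. s \<in> {0..T} \<Longrightarrow> g s \<le> g t0"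
    using continuous_attains_sup[of "{0..T}" g] T by auto
  define e where "e = energy k t0"
  define w where "w = t0 powr p"
  have "b < g t"
  proof -
    have "b / t powr p < energy k t" using viol scale[of t] t by (simp add: p_def)
    then show ?thesis using t by (simp add: g_def pos_divide_less_eq)
  qed
  also have "g t \<le> e * w" using t0(2)[of t] t by (simp add: g_def e_def w_def)
  finally have ew: "b < e * w" .
  have t0_pos: "t0 > 0"
  proof (rule ccontr)
    assume "\<not> 0 < t0"
    then have "t0 = 0" using t0(1) by auto
    then show False using ew b0 p by (simp add: w_def)
  qed
  have w: "w > 0" using t0_pos by (simp add: w_def)
  have e: "e > 0" using ew b0 w by (smt (verit) zero_less_mult_pos2)
  have be: "b / w < e" using ew w by (simp add: field_simps)
  have kn: "k \<le> n" using e energy_above[of k t0] by (force simp: e_def)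
  \<comment> \<open>Since \<open>\<rho>\<^sup>2 * q = 1\<close>, going up one shell and back to time
    \<open>r\<close> turns \<open>q ^ k * t0\<close> into \<open>q ^ k * t0 / \<rho>\<close>. The
    bound known for shell \<open>k + 1\<close> thus gains a factor
    \<open>\<rho> powr p \<le> \<rho>\<close>, which makes the energy above \<open>k\<close> at most
    \<open>\<rho> * e\<close>.\<close>
  define r where "r = \<rho> * t0"
  have r: "0 < r" "r < t0" "r \<le> T" using \<rho> t0_pos t0(1) by (auto simp: r_def intro: order_trans[of _ t0] mult_left_le_one_le)
  have e_le: "e \<le> energy k s" if "s \<in> {r..t0}" for s
    unfolding e_def using that r k by (intro energy_antimono) auto
  have top: "energy (Suc k) s \<le> \<rho> * e" if s: "s \<in> {r..t0}" for s
  proof -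
    have "energy (Suc k) s \<le> energy (Suc k) r" using s r by (intro energy_antimono) auto
    also have "\<dots> \<le> A * (q ^ Suc k * r) powr (- p)" using IH[of r] r by (simp add: p_def)
    also have "q ^ Suc k * r = q ^ k * ((1 / \<rho>) * t0)"
      using \<rho> by (simp add: r_def q_eq power2_eq_square field_simps)
    also have "A * (q ^ k * ((1 / \<rho>) * t0)) powr (- p) = b / w * \<rho> powr p"
      using \<rho> t0_pos by (subst scale) (auto simp: w_def powr_divide)
    also have "\<dots> \<le> e * \<rho> powr 1"
      using be \<rho> p b0 w e by (intro mult_mono powr_mono') auto
    finally show ?thesis using \<rho> by (simp add: mult.commute)
  qed
  have conc: "(1 - \<rho>) * e \<le> (x s k)\<^sup>2" if s: "s \<in> {r..t0}" for s
  proof -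
    have "s \<ge> 0" using s r by auto
    then show ?thesis using energy_Suc[of s k] e_le[OF s] top[OF s] by (simp add: algebra_simps)
  qed
  \<comment> \<open>The assumed decay at the lowest shell \<open>k - 2\<close> and the earliest time
    \<open>r\<close> bounds both \<open>x s (k - 2)\<close> and \<open>x s (k - 1)\<close> on the
    interval.\<close>
  define M where "M = B * (q ^ (k - 2) * r) powr (- \<gamma>)"
  have M0: "M \<ge> 0" using B by (simp add: M_def)
  have x_M: "x s j \<le> M" if s: "s \<in> {r..t0}" and j: "j \<ge> k - 2" for s j
  proof -
    have "x s j \<le> B * (q ^ j * s) powr (- \<gamma>)" using s r t0(1) by (intro dec) auto
    also have "\<dots> \<le> M"
      unfolding M_def using s r q1 \<gamma> j
      by (intro mult_left_mono powr_mono2' mult_mono power_increasing B) auto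
    finally show ?thesis .
  qed
  \<comment> \<open>A lower bound for the inflow of shell \<open>k - 1\<close> while shell
    \<open>k\<close> holds the share \<open>(1 - \<rho>) * e\<close>.\<close>
  define m where "m = q ^ (k - 1) * ((1 - \<rho>) * e)"
  \<comment> \<open>The weight \<open>c * M / e\<close> is fitted to the losses of shell
    \<open>k - 1\<close>: as \<open>2 * c * (1 - \<rho>) = 1\<close>, the flux out of shell
    \<open>k\<close> pays for the outflow to \<open>k - 2\<close>, and as
    \<open>2 * c \<ge> 1\<close>, the damping of \<open>energy k\<close> pays for the damping. What
    is left grows at rate at least \<open>m\<close>.\<close>
  define \<Phi> where "\<Phi> s = x s (k - 1) - c * M / e * energy k s" for s
  have "\<Phi> r - m * r \<le> \<Phi> t0 - m * t0"
  proof (rule DERIV_nonneg_imp_increasing_open[where f = "\<lambda>s. \<Phi> s - m * s"])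
    show "r \<le> t0" using r by simp
    show "continuous_on {r..t0} (\<lambda>s. \<Phi> s - m * s)"
      unfolding \<Phi>_def using r
      by (intro continuous_intros continuous_on_subset[OF energy_cont] continuous_on_subset[OF x_cont]) auto
  next
    fix s assume s_in: "r < s" "s < t0"
    then have s: "s \<in> {r..t0}" "s > 0" using r by auto
    define y where "y = x s (k - 1)"
    have y: "0 \<le> y" "y \<le> M" using s x_M[of s "k - 1"] by (auto simp: y_def intro: x_nonneg)
    obtain D where D: "(energy k has_real_derivative D) (at s)"
      "D \<le> - 2 * d k * energy k s - 2 * a (k - 1) * y * (x s k)\<^sup>2"
      using energy_decay[of s k] s k d_mono by (auto simp: at_within_atLeast_pos y_def)
    define x' where "x' = - d (k - 1) * y + a (k - 1) * (x s k)\<^sup>2 - a (k - 2) * x s (k - 2) * y"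
    have km: "k - Suc (Suc 0) = k - 2" "Suc (k - Suc 0) = k" using k by auto
    have "k - 1 \<in> {1..n}" using k kn by auto
    then have dx: "((\<lambda>s. x s (k - 1)) has_real_derivative x') (at s)"
      using x_ode[of s "k - 1"] s by (simp add: at_within_atLeast_pos x'_def y_def km)
    have "D \<le> - (2 * d k * e + 2 * a (k - 1) * y * ((1 - \<rho>) * e))"
    proof -
      have "2 * d k * e \<le> 2 * d k * energy k s"
        using e_le[OF s(1)] d_nonneg[of k] by (intro mult_left_mono) auto
      moreover have "2 * a (k - 1) * y * ((1 - \<rho>) * e) \<le> 2 * a (k - 1) * y * (x s k)\<^sup>2"
        using conc[OF s(1)] a_nonneg[of "k - 1"] y by (intro mult_left_mono) auto
      ultimately show ?thesis using D(2) by linarith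
    qed
    then have "c * M / e * D \<le> c * M / e * (- (2 * d k * e + 2 * a (k - 1) * y * ((1 - \<rho>) * e)))"
      using c M0 e by (intro mult_left_mono) auto
    also have "\<dots> = - (2 * c * (d k * M) + (2 * c * (1 - \<rho>)) * (a (k - 1) * M * y))"
      using e by (simp add: field_simps)
    also have "\<dots> \<le> - (1 * (d (k - 1) * y) + a (k - 1) * M * y)"
    proof -
      have "1 * (d (k - 1) * y) \<le> 2 * c * (d k * M)"
        using c y d_nonneg d_mono[of "k - 1" k] by (intro mult_mono) (auto intro: mult_mono)
      then show ?thesis unfolding c(3) by simp
    qed
    finally have 1: "c * M / e * D \<le> - (d (k - 1) * y + a (k - 1) * M * y)" by simp
    have "a (k - 2) * x s (k - 2) * y \<le> a (k - 1) * M * y"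
      unfolding a_eq using q1 y x_M[OF s(1), of "k - 2"] s M0
      by (intro mult_mono power_increasing) (auto intro!: x_nonneg mult_nonneg_nonneg)
    moreover have "m \<le> a (k - 1) * (x s k)\<^sup>2"
      unfolding m_def a_eq using conc[OF s(1)] q1 by (intro mult_left_mono) auto
    ultimately have "0 \<le> x' - c * M / e * D - m"
      using 1 unfolding x'_def by linarith
    moreover have "((\<lambda>s. \<Phi> s - m * s) has_real_derivative x' - c * M / e * D - m * 1) (at s)"
      unfolding \<Phi>_def by (intro derivative_intros dx DERIV_cmult D(1) DERIV_ident)
    ultimately show "\<exists>y. ((\<lambda>s. \<Phi> s - m * s) has_real_derivative y) (at s) \<and> 0 \<le> y"
      by auto
  qed
  then have "m * (t0 - r) \<le> \<Phi> t0 - \<Phi> r" by (simp add: algebra_simps)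
  also have "\<dots> \<le> M + c * M * q"
  proof -
    have "\<Phi> t0 \<le> M"
    proof -
      have "x t0 (k - 1) \<le> M" using r by (intro x_M) auto
      moreover have "0 \<le> c * M / e * energy k t0" using c M0 e energy_nonneg[of k t0] by simp
      ultimately show ?thesis unfolding \<Phi>_def by linarith
    qed
    moreover have "- \<Phi> r \<le> c * M / e * energy k r"
      using x_nonneg[of r "k - 1"] r by (simp add: \<Phi>_def)
    \<comment> \<open>Maximality of \<open>g\<close> at \<open>t0\<close> limits the drop of the
      energy over the interval to the factor \<open>\<rho> powr (- p)\<close>, which is at most
      \<open>q\<close> because \<open>p \<le> 2\<close>.\<close>
    moreover have "c * M / e * energy k r \<le> c * M / e * (e * q)"
    proof -
      have "energy k r * r powr p \<le> e * w" using t0(2)[of r] r by (simp add: g_def e_def w_def)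
      also have "r powr p = \<rho> powr p * w" using \<rho> t0_pos by (simp add: r_def w_def powr_mult)
      finally have "energy k r * \<rho> powr p \<le> e" using w by simp
      moreover have "\<rho>\<^sup>2 \<le> \<rho> powr p" using powr_mono'[of p 2 \<rho>] p \<rho> by (simp flip: powr_numeral)
      ultimately have "energy k r * \<rho>\<^sup>2 \<le> e"
        using energy_nonneg[of k r] by (meson mult_left_mono order_trans)
      then have "energy k r \<le> e * q" using \<rho> by (simp add: q_eq field_simps)
      then show ?thesis using c M0 e by (intro mult_left_mono) auto
    qed
    moreover have "c * M / e * (e * q) = c * M * q" using e by simp
    ultimately show ?thesis by linarith
  qed
  finally have main: "m * (t0 - r) \<le> M * (1 + c * q)" by (simp add: algebra_simps)
  \<comment> \<open>In terms of \<open>Z\<close> the gain exceeds a multiple of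
    \<open>A * Z powr (- \<gamma>)\<close> and the losses are at most a multiple of
    \<open>B * Z powr (- \<gamma>)\<close>. The powers of \<open>Z\<close> cancel, and the size of
    \<open>A\<close> relative to \<open>B\<close> gives the contradiction.\<close>
  define Z where "Z = q ^ k * t0"
  have Z: "Z > 0" using q1 t0_pos by (simp add: Z_def)
  have "M = B * (Z * (\<rho> / q\<^sup>2)) powr (- \<gamma>)"
  proof -
    have "q ^ k = q ^ (k - 2) * q\<^sup>2" using k by (simp only: power_add[symmetric] le_add_diff_inverse2)
    then show ?thesis using q1 by (simp add: M_def Z_def r_def mult_ac)
  qed
  also have "\<dots> = B * Z powr (- \<gamma>) * (q\<^sup>2 / \<rho>) powr \<gamma>"
    using Z q1 \<rho> by (simp add: powr_mult powr_minus powr_divide field_simps)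
  also have "\<dots> \<le> B * Z powr (- \<gamma>) * (q\<^sup>2 / \<rho>) powr 1"
  proof (intro mult_left_mono powr_mono)
    have "1 \<le> q\<^sup>2" using q1 by (simp add: one_le_power)
    then show "1 \<le> q\<^sup>2 / \<rho>" using \<rho> by (simp add: field_simps)
  qed (use \<gamma> B in auto)
  finally have M_le: "M \<le> B * Z powr (- \<gamma>) * (q\<^sup>2 / \<rho>)" using q1 \<rho> by simp
  have "A / q * (1 - \<rho>)\<^sup>2 * Z powr (- \<gamma>) < m * (t0 - r)"
  proof -
    have qk: "q ^ (k - 1) * t0 = Z / q"
      using k q1 by (cases k) (auto simp: Z_def)
    have "b / w = A * Z powr (- p)" using scale[OF t0_pos] by (simp add: w_def Z_def)
    also have "Z powr (- p) = Z powr (- \<gamma>) / Z"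
      using Z by (simp add: p_def powr_diff powr_minus powr_add field_simps)
    finally have bw: "b / w = A * (Z powr (- \<gamma>) / Z)" .
    have "A / q * (1 - \<rho>)\<^sup>2 * Z powr (- \<gamma>) = (Z / q) * (1 - \<rho>)\<^sup>2 * (b / w)"
      unfolding bw using Z q1 by (simp add: field_simps)
    also have "\<dots> < (Z / q) * (1 - \<rho>)\<^sup>2 * e"
      using Z q1 \<rho> by (intro mult_strict_left_mono be) auto
    also have "\<dots> = m * (t0 - r)"
      unfolding qk[symmetric] by (simp add: m_def r_def power2_eq_square algebra_simps)
    finally show ?thesis .
  qed
  also note main
  also have "M * (1 + c * q) \<le> B * Z powr (- \<gamma>) * (q\<^sup>2 / \<rho>) * (1 + c * q)"
    using c q1 by (intro mult_right_mono M_le) auto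
  finally have "Z powr (- \<gamma>) * (A / q * (1 - \<rho>)\<^sup>2) < Z powr (- \<gamma>) * (B * (q\<^sup>2 / \<rho>) * (1 + c * q))"
    by (simp add: mult_ac)
  then have "A / q * (1 - \<rho>)\<^sup>2 < B * (q\<^sup>2 / \<rho>) * (1 + c * q)"
    by (rule mult_left_less_imp_less) simp
  moreover have "B * (q\<^sup>2 / \<rho>) * (1 + c * q) \<le> A / q * (1 - \<rho>)\<^sup>2"
  proof -
    have "B * v * q ^ 3 / (\<rho> * u) * (u / q) = B * (q\<^sup>2 / \<rho>) * v" if "u \<noteq> 0" for u v
      using that q1 \<rho> by (simp add: power2_eq_square power3_eq_cube)
    from this[of "(1 - \<rho>)\<^sup>2" "1 + c * q"]
    have "B * (q\<^sup>2 / \<rho>) * (1 + c * q) = B * (1 + c * q) * q ^ 3 / (\<rho> * (1 - \<rho>)\<^sup>2) * ((1 - \<rho>)\<^sup>2 / q)"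
      using \<rho> by simp
    also have "\<dots> \<le> A * ((1 - \<rho>)\<^sup>2 / q)"
      using A q1 by (intro mult_right_mono) (auto simp: c_def)
    finally show ?thesis by simp
  qed
  ultimately show False by simp
qed

text \<open>Downward induction on the shell, starting above \<open>n\<close> where the tail is
  empty. Each step keeps the same \<open>A\<close>, so the bound does not depend on
  \<open>n\<close>. Shell 1 has no shell below it to feed; there the energy is at most 1 and the
  second condition on \<open>A\<close> suffices for times up to \<open>T\<close>.\<close>

lemma (in truncated) tail_bound:
  fixes q \<rho> \<gamma> T A B :: real
  assumes a_eq: "\<And>j. a j = q ^ j" and \<rho>: "0 < \<rho>" "\<rho> < 1" and q\<rho>: "\<rho>\<^sup>2 * q = 1"
    and d_mono: "\<And>i j. i \<le> j \<Longrightarrow> d i \<le> d j" and \<gamma>: "0 \<le> \<gamma>" "\<gamma> \<le> 1" and T: "T > 0" and B: "B \<ge> 0"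
    and dec: "\<And>j t. 0 < t \<Longrightarrow> t \<le> T \<Longrightarrow> x t j \<le> B * (q ^ j * t) powr (- \<gamma>)"
    and A: "B * (1 + q / (2 * (1 - \<rho>))) * q ^ 3 / (\<rho> * (1 - \<rho>)\<^sup>2) \<le> A" "(q * T) powr (1 + \<gamma>) \<le> A"
    and k: "k \<ge> 1" and t: "0 < t" "t \<le> T"
  shows "energy k t \<le> A * (q ^ k * t) powr (- (1 + \<gamma>))"
  using k t
proof (induction "Suc n - k" arbitrary: k t)
  case 0
  then have "energy k t = 0" by (intro energy_above) auto
  moreover have "A \<ge> 0" using A(2) by (rule order_trans[rotated]) simp
  ultimately show ?case by simp
next
  case (Suc i)
  have q0: "q > 0" using q\<rho> \<rho> by (smt (verit) mult_nonneg_nonpos zero_le_power2)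
  show ?case
  proof (cases "k = 1")
    case True
    have "energy k t \<le> 1" using Suc by (intro energy_le_1) auto
    also have "1 = (q * T) powr (1 + \<gamma>) * (q * T) powr (- (1 + \<gamma>))"
      using q0 T by (simp flip: powr_add)
    also have "\<dots> \<le> A * (q ^ k * t) powr (- (1 + \<gamma>))"
      using q0 T Suc.prems \<gamma> True order_trans[OF powr_ge_zero A(2)] by (intro mult_mono A(2) powr_mono2') auto
    finally show ?thesis .
  next
    case False
    have IH: "energy (Suc k) s \<le> A * (q ^ Suc k * s) powr (- (1 + \<gamma>))" if "0 < s" "s \<le> T" for s
      using Suc.hyps(2) that by (intro Suc.hyps(1)) auto
    show ?thesis
      by (rule tail_bound_descend[OF a_eq \<rho> q\<rho> d_mono \<gamma> T B dec _ IH A(1)])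
        (use False Suc.prems in auto)
  qed
qed

text \<open>Bootstrap in \<open>m\<close>. The bound \<open>x \<le> 1\<close> gives exponent 1 for
  the energy. A square root halves the exponent for single components, and the preceding lemma adds
  1, so the distance to 2 is halved each time. The constant is chosen before \<open>n\<close> and
  \<open>x\<close>.\<close>

lemma tail_bound_uniform:
  fixes q T :: real
  assumes q: "q > 1" and T: "T > 0" and d_mono: "\<And>i j. i \<le> j \<Longrightarrow> d i \<le> d j"
  shows "\<exists>A\<ge>0. \<forall>n x. truncated d (\<lambda>k. q ^ k) n x \<longrightarrow> (\<forall>k\<ge>1. \<forall>t. 0 < t \<longrightarrow> t \<le> T \<longrightarrow>
      truncated.energy n x k t \<le> A * (q ^ k * t) powr (- (2 - (1 / 2) ^ m)))"
proof -
  define \<rho> where "\<rho> = 1 / sqrt q"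
  have \<rho>: "0 < \<rho>" "\<rho> < 1" "\<rho>\<^sup>2 * q = 1"
    using q by (auto simp: \<rho>_def power_divide)
  have step: "\<exists>A\<ge>0. \<forall>n x. truncated d (\<lambda>k. q ^ k) n x \<longrightarrow> (\<forall>k\<ge>1. \<forall>t. 0 < t \<longrightarrow> t \<le> T \<longrightarrow>
      truncated.energy n x k t \<le> A * (q ^ k * t) powr (- (1 + \<gamma>)))"
    if \<gamma>: "0 \<le> \<gamma>" "\<gamma> \<le> 1" and B: "B \<ge> 0"
      and dec: "\<And>n x j t. truncated d (\<lambda>k. q ^ k) n x \<Longrightarrow> 0 < t \<Longrightarrow> t \<le> T \<Longrightarrow> x t j \<le> B * (q ^ j * t) powr (- \<gamma>)"
    for \<gamma> B
  proof -
    define A where "A = max (B * (1 + q / (2 * (1 - \<rho>))) * q ^ 3 / (\<rho> * (1 - \<rho>)\<^sup>2)) ((q * T) powr (1 + \<gamma>))"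
    show ?thesis
    proof (intro exI[of _ A] conjI allI impI)
      show "A \<ge> 0" unfolding A_def by (simp add: le_max_iff_disj)
      fix n k :: nat and x and t :: real
      assume tr: "truncated d (\<lambda>k. q ^ k) n x" and "k \<ge> 1" "0 < t" "t \<le> T"
      then show "truncated.energy n x k t \<le> A * (q ^ k * t) powr (- (1 + \<gamma>))"
        by (intro truncated.tail_bound[OF tr refl \<rho> d_mono \<gamma> T B dec[OF tr]]) (auto simp: A_def)
    qed
  qed
  show ?thesis
  proof (induction m)
    case 0
    have "\<exists>A\<ge>0. \<forall>n x. truncated d (\<lambda>k. q ^ k) n x \<longrightarrow> (\<forall>k\<ge>1. \<forall>t. 0 < t \<longrightarrow> t \<le> T \<longrightarrow>
      truncated.energy n x k t \<le> A * (q ^ k * t) powr (- (1 + 0)))"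
      by (rule step[of _ 1]) (use q in \<open>auto intro: truncated.x_le_1\<close>)
    then show ?case by simp
  next
    case (Suc m)
    then obtain A where A: "A \<ge> 0" and en: "\<And>n x k t. truncated d (\<lambda>k. q ^ k) n x \<Longrightarrow> k \<ge> 1 \<Longrightarrow> 0 < t \<Longrightarrow> t \<le> T \<Longrightarrow>
      truncated.energy n x k t \<le> A * (q ^ k * t) powr (- (2 - (1 / 2) ^ m))" by blast
    have "\<exists>A\<ge>0. \<forall>n x. truncated d (\<lambda>k. q ^ k) n x \<longrightarrow> (\<forall>k\<ge>1. \<forall>t. 0 < t \<longrightarrow> t \<le> T \<longrightarrow>
      truncated.energy n x k t \<le> A * (q ^ k * t) powr (- (1 + (1 - (1 / 2) ^ Suc m))))"
    proof (rule step[of _ "sqrt A"])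
      fix n x j and t :: real
      assume tr: "truncated d (\<lambda>k. q ^ k) n x" and t: "0 < t" "t \<le> T"
      show "x t j \<le> sqrt A * (q ^ j * t) powr (- (1 - (1 / 2) ^ Suc m))"
      proof (cases "j = 0")
        case True
        then show ?thesis using truncated.x_zero[OF tr, of t] t A by simp
      next
        case False
        have "x t j = sqrt ((x t j)\<^sup>2)" using truncated.x_nonneg[OF tr, of t j] t by simp
        also have "\<dots> \<le> sqrt (A * (q ^ j * t) powr (- (2 - (1 / 2) ^ m)))"
          using truncated.sq_le_energy[OF tr, of t j] en[OF tr, of j t] t False
          by (intro real_sqrt_le_mono) auto
        also have "\<dots> = sqrt A * (q ^ j * t) powr (- (1 - (1 / 2) ^ Suc m))"
          by (simp add: real_sqrt_mult powr_powr field_simps flip: powr_half_sqrt)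
        finally show ?thesis .
      qed
    qed (use A power_le_one[of "1 / 2 :: real" m] in auto)
    then show ?case by (simp add: algebra_simps)
  qed
qed

text \<open>For \<open>z \<le> 1\<close> the trivial bound 1 is enough; for \<open>z > 1\<close>
  lowering the exponent weakens the bound.\<close>

lemma le_powr_interpolate:
  fixes y A z p r :: real
  assumes "y \<le> 1" "y \<le> A * z powr (- p)" "0 \<le> r" "r \<le> p" "A \<ge> 1" "z > 0"
  shows "y \<le> A * z powr (- r)"
proof (cases "z \<le> 1")
  case True
  then have "1 \<le> z powr (- r)" using assms powr_mono2'[of "- r" z 1] by simp
  then have "1 * 1 \<le> A * z powr (- r)" using \<open>A \<ge> 1\<close> by (intro mult_mono) auto
  then show ?thesis using assms by simp
next
  case False
  then have "A * z powr (- p) \<le> A * z powr (- r)"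
    using assms by (intro mult_left_mono powr_mono) auto
  then show ?thesis using assms(2) by linarith
qed

text \<open>Energy is lost only by damping. Inserting the tail bound with a suitable exponent
  \<open>\<theta>\<close> into the damping sum makes it geometric in the shell and integrable in
  time near 0, uniformly in \<open>n\<close>. The condition \<open>l < q\<close> encodes
  \<open>\<alpha> > 2\<close>.\<close>

lemma energy_lower_uniform:
  fixes \<nu> l q :: real
  assumes \<nu>: "\<nu> > 0" and l: "1 < l" "l < q"
  shows "\<exists>C \<sigma>. 0 < \<sigma> \<and> 0 \<le> C \<and> (\<forall>n x. truncated (\<lambda>k. \<nu> * l ^ k) (\<lambda>k. q ^ k) n x \<longrightarrow>
    (\<forall>t. 0 \<le> t \<longrightarrow> t \<le> 1 \<longrightarrow> 1 - C * t powr \<sigma> \<le> truncated.energy n x 1 t))"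
proof -
  \<comment> \<open>The midpoint of \<open>ln l / ln q\<close> and 1: above the former,
    \<open>l / q powr \<theta> < 1\<close> and the sum over shells converges; below 1,
    \<open>s powr (- \<theta>)\<close> is integrable at 0.\<close>
  define \<theta> where "\<theta> = (ln l / ln q + 1) / 2"
  have lns: "0 < ln l" "ln l < ln q" using l by auto
  then have th: "ln l / ln q < \<theta>" "0 < \<theta>" "\<theta> < 1" by (auto simp: \<theta>_def field_simps)
  define r where "r = l / q powr \<theta>"
  have "l < q powr \<theta>"
  proof -
    have "ln l < \<theta> * ln q" using th(1) lns by (simp add: field_simps)
    then have "exp (ln l) < exp (\<theta> * ln q)" by simp
    then show ?thesis using l by (simp add: powr_def)
  qed
  then have r: "0 < r" "r < 1" using l by (auto simp: r_def field_simps)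
  obtain A0 where en0: "\<And>n x k t. truncated (\<lambda>k. \<nu> * l ^ k) (\<lambda>k. q ^ k) n x \<Longrightarrow> k \<ge> 1 \<Longrightarrow> 0 < t \<Longrightarrow> t \<le> 1 \<Longrightarrow>
      truncated.energy n x k t \<le> A0 * (q ^ k * t) powr (- 1)"
  proof -
    have "\<exists>A\<ge>0. \<forall>n x. truncated (\<lambda>k. \<nu> * l ^ k) (\<lambda>k. q ^ k) n x \<longrightarrow> (\<forall>k\<ge>1. \<forall>t. 0 < t \<longrightarrow> t \<le> 1 \<longrightarrow>
      truncated.energy n x k t \<le> A * (q ^ k * t) powr (- (2 - (1 / 2) ^ 0)))"
      by (rule tail_bound_uniform) (use \<nu> l in \<open>auto intro: power_increasing\<close>)
    moreover have "- (2 - (1 / 2) ^ 0) = (- 1 :: real)" by simp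
    ultimately show ?thesis using that by (metis (no_types, lifting))
  qed
  define A where "A = max A0 1"
  have en: "(x t k)\<^sup>2 \<le> A * (q ^ k * t) powr (- \<theta>)"
    if tr: "truncated (\<lambda>k. \<nu> * l ^ k) (\<lambda>k. q ^ k) n x" and "k \<ge> 1" "0 < t" "t \<le> 1" for n x k t
  proof (rule le_powr_interpolate)
    have "(x t k)\<^sup>2 \<le> truncated.energy n x k t"
      using truncated.sq_le_energy[OF tr] that by simp
    also have "\<dots> \<le> A0 * (q ^ k * t) powr (- 1)" by (rule en0[OF that])
    also have "\<dots> \<le> A * (q ^ k * t) powr (- 1)" by (intro mult_right_mono) (auto simp: A_def)
    finally show "(x t k)\<^sup>2 \<le> A * (q ^ k * t) powr (- 1)" .
    show "(x t k)\<^sup>2 \<le> 1"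
      using truncated.x_le_1[OF tr, of t k] truncated.x_nonneg[OF tr, of t k] that by (simp add: power_le_one)
  qed (use th that l in \<open>auto simp: A_def\<close>)
  define \<sigma> where "\<sigma> = 1 - \<theta>"
  have \<sigma>: "\<sigma> > 0" using th by (simp add: \<sigma>_def)
  \<comment> \<open>Chosen so that the derivative of \<open>C * s powr \<sigma>\<close> equals the
    bound on the damping rate, which makes \<open>h\<close> below nondecreasing.\<close>
  define C where "C = 2 * (\<nu> * A / (1 - r)) / \<sigma>"
  have C: "C \<ge> 0" using \<nu> r \<sigma> by (auto simp: C_def A_def intro!: divide_nonneg_nonneg mult_nonneg_nonneg)
  show ?thesis
  proof (rule exI[of _ C], rule exI[of _ \<sigma>], intro conjI \<sigma> C allI impI)
    fix n x and t :: real
    assume tr: "truncated (\<lambda>k. \<nu> * l ^ k) (\<lambda>k. q ^ k) n x" and t: "0 \<le> t" "t \<le> 1"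
    interpret truncated "\<lambda>k. \<nu> * l ^ k" "\<lambda>k. q ^ k" n x by (rule tr)
    define h where "h s = energy 1 s + C * s powr \<sigma>" for s
    have "h 0 \<le> h t"
    proof (rule DERIV_nonneg_imp_increasing_open[where f = h, OF t(1)])
      fix s assume s: "0 < s" "s < t"
      have "(\<Sum>j=1..n. \<nu> * l ^ j * (x s j)\<^sup>2) \<le> (\<Sum>j=1..n. \<nu> * A * s powr (- \<theta>) * r ^ j)"
      proof (rule sum_mono)
        fix j assume j: "j \<in> {1..n}"
        have "\<nu> * l ^ j * (x s j)\<^sup>2 \<le> \<nu> * l ^ j * (A * (q ^ j * s) powr (- \<theta>))"
          using en[OF tr, of j s] j s t \<nu> l by (intro mult_left_mono) auto
        also have "(q ^ j * s) powr (- \<theta>) = s powr (- \<theta>) / (q powr \<theta>) ^ j"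
        proof -
          have "(q ^ j) powr \<theta> = (q powr \<theta>) ^ j"
            using l by (simp add: powr_powr mult.commute flip: powr_realpow)
          then show ?thesis using l s by (simp add: powr_mult powr_minus field_simps)
        qed
        finally show "\<nu> * l ^ j * (x s j)\<^sup>2 \<le> \<nu> * A * s powr (- \<theta>) * r ^ j"
          by (simp add: r_def power_divide mult_ac)
      qed
      also have "\<dots> = \<nu> * A * s powr (- \<theta>) * (\<Sum>j=1..n. r ^ j)"
        by (simp add: sum_distrib_left)
      also have "\<dots> \<le> \<nu> * A * s powr (- \<theta>) * (1 / (1 - r))"
      proof (rule mult_left_mono)
        have "(\<Sum>j=1..n. r ^ j) \<le> (\<Sum>j. r ^ j)"
          using r by (intro sum_le_suminf) (auto simp: summable_geometric_iff)
        then show "(\<Sum>j=1..n. r ^ j) \<le> 1 / (1 - r)" using r by (simp add: suminf_geometric)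
      qed (use \<nu> in \<open>auto simp: A_def\<close>)
      finally have diss0: "(\<Sum>j=1..n. \<nu> * l ^ j * (x s j)\<^sup>2) \<le> \<nu> * A * s powr (- \<theta>) * (1 / (1 - r))" .
      have diss: "2 * (\<Sum>j=1..n. \<nu> * l ^ j * (x s j)\<^sup>2) \<le> C * (\<sigma> * s powr (\<sigma> - 1))"
      proof -
        have "C * (\<sigma> * u) = 2 * (\<nu> * A * u * (1 / (1 - r)))" for u using \<sigma> by (simp add: C_def)
        moreover have "\<sigma> - 1 = - \<theta>" by (simp add: \<sigma>_def)
        ultimately show ?thesis
          using diss0 by simp
      qed
      \<comment> \<open>The flux out of shell 1 carries the factor \<open>x s 0 = 0\<close>, so no
        energy leaves through the bottom.\<close>
      have hd: "(h has_real_derivative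
          (- 2 * (\<Sum>j=1..n. \<nu> * l ^ j * (x s j)\<^sup>2) - 2 * q ^ (1 - 1) * x s (1 - 1) * (x s 1)\<^sup>2)
            + C * (\<sigma> * s powr (\<sigma> - 1))) (at s)"
        unfolding h_def using s energy_deriv[of s 1]
        by (intro DERIV_add DERIV_cmult has_real_derivative_powr) (auto simp: at_within_atLeast_pos)
      show "\<exists>y. (h has_real_derivative y) (at s) \<and> 0 \<le> y"
        by (rule exI, rule conjI[OF hd]) (use diss x_zero[of s] s in auto)
    next
      show "continuous_on {0..t} h"
        unfolding h_def using \<sigma>
        by (intro continuous_intros continuous_on_powr' continuous_on_subset[OF energy_cont]) auto
    qed
    moreover have "h 0 = 1" using \<sigma> n_pos by (simp add: h_def energy_init)
    ultimately show "1 - C * t powr \<sigma> \<le> energy 1 t" by (simp add: h_def)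
  qed
qed

subsection \<open>Passage to the limit\<close>

text \<open>A diagonal argument gives convergence for all shells at nonnegative rational times; the
  Lipschitz bounds, uniform in \<open>n\<close>, carry it to every time.\<close>

lemma equi_lipschitz_subsequence:
  fixes f :: "nat \<Rightarrow> nat \<Rightarrow> real \<Rightarrow> real"
  assumes bound: "\<And>n k t. t \<ge> 0 \<Longrightarrow> \<bar>f n k t\<bar> \<le> M"
    and lip: "\<And>n k s t. s \<ge> 0 \<Longrightarrow> t \<ge> 0 \<Longrightarrow> \<bar>f n k t - f n k s\<bar> \<le> L k * \<bar>t - s\<bar>"
  obtains r X where "strict_mono (r :: nat \<Rightarrow> nat)" "\<And>k t. t \<ge> 0 \<Longrightarrow> (\<lambda>i. f (r i) k t) \<longlonglongrightarrow> X k t"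
proof -
  define S where "S = (UNIV :: nat set) \<times> (\<rat> \<inter> {0..} :: real set)"
  have "countable S"
    unfolding S_def by (intro countable_SIGMA countable_Int1 countable_rat) auto
  moreover have "norm (case p of (k, t) \<Rightarrow> f n k t) \<le> M" if "p \<in> S" for n p
    using that bound by (auto simp: S_def)
  ultimately obtain r where r: "strict_mono (r :: nat \<Rightarrow> nat)"
    and conv: "\<And>p. p \<in> S \<Longrightarrow> \<exists>y. (\<lambda>i. case p of (k, t) \<Rightarrow> f (r i) k t) \<longlonglongrightarrow> y"
    using function_convergent_subsequence[of S "\<lambda>n p. case p of (k, t) \<Rightarrow> f n k t" M] by blast
  have "convergent (\<lambda>i. f (r i) k t)" if t: "t \<ge> 0" for k t
  proof (rule Cauchy_convergent, rule metric_CauchyI)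
    fix e :: real assume e: "e > 0"
    define \<delta> where "\<delta> = e / (3 * (\<bar>L k\<bar> + 1))"
    have \<delta>: "\<delta> > 0" using e by (simp add: \<delta>_def)
    obtain s where s: "s \<in> \<rat>" "t < s" "s < t + \<delta>"
      using Rats_dense_in_real[of t "t + \<delta>"] \<delta> by auto
    have near: "\<bar>f n k t - f n k s\<bar> < e / 3" for n
    proof -
      have "\<bar>f n k t - f n k s\<bar> \<le> (\<bar>L k\<bar> + 1) * \<bar>t - s\<bar>"
        using lip[of s t n k] s t by (intro order_trans[OF lip] mult_right_mono) auto
      also have "\<dots> < (\<bar>L k\<bar> + 1) * \<delta>" using s by (intro mult_strict_left_mono) auto
      also have "\<dots> = e / 3" 
      proof -
        have "v * (e / (3 * v)) = e / 3" if "v > 0" for v :: real using that by simp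
        from this[of "\<bar>L k\<bar> + 1"] show ?thesis by (simp add: \<delta>_def)
      qed
      finally show ?thesis .
    qed
    have "Cauchy (\<lambda>i. f (r i) k s)"
      using conv[of "(k, s)"] s t by (auto simp: S_def intro: LIMSEQ_imp_Cauchy)
    from metric_CauchyD[OF this, of "e / 3"] obtain I where
      I: "\<And>i j. i \<ge> I \<Longrightarrow> j \<ge> I \<Longrightarrow> \<bar>f (r i) k s - f (r j) k s\<bar> < e / 3"
      using e by (auto simp: dist_real_def)
    show "\<exists>I. \<forall>i\<ge>I. \<forall>j\<ge>I. dist (f (r i) k t) (f (r j) k t) < e"
    proof (intro exI[of _ I] allI impI)
      fix i j assume "i \<ge> I" "j \<ge> I"
      then show "dist (f (r i) k t) (f (r j) k t) < e"
        using I[of i j] near[of "r i"] near[of "r j"] unfolding dist_real_def by linarith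
    qed
  qed
  then have "\<forall>k t. \<exists>y. t \<ge> 0 \<longrightarrow> (\<lambda>i. f (r i) k t) \<longlonglongrightarrow> y"
    by (auto simp: convergent_def)
  then obtain X where "\<And>k t. t \<ge> 0 \<Longrightarrow> (\<lambda>i. f (r i) k t) \<longlonglongrightarrow> X k t" by metis
  with r show ?thesis by (rule that)
qed

text \<open>The condition \<open>i < n i\<close> pushes the initially charged shell to infinity, so
  every fixed shell eventually starts at 0.\<close>

locale truncation_limit =
  fixes d a :: "nat \<Rightarrow> real" and n :: "nat \<Rightarrow> nat" and x :: "nat \<Rightarrow> real \<Rightarrow> nat \<Rightarrow> real" and X :: "real \<Rightarrow> nat \<Rightarrow> real"
  assumes trunc: "\<And>i. truncated d a (n i) (x i)" and n_large: "\<And>i. i < n i"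
    and lim: "\<And>t k. t \<ge> 0 \<Longrightarrow> (\<lambda>i. x i t k) \<longlonglongrightarrow> X t k"
begin

lemma X_zero: "t \<ge> 0 \<Longrightarrow> X t 0 = 0"
  using lim[of t 0] truncated.x_zero[OF trunc] by (simp add: LIMSEQ_const_iff)

lemma X_nonneg: "t \<ge> 0 \<Longrightarrow> X t k \<ge> 0"
  by (rule LIMSEQ_le_const[OF lim]) (auto intro: truncated.x_nonneg[OF trunc])

lemma X_le_1: "t \<ge> 0 \<Longrightarrow> X t k \<le> 1"
  by (rule LIMSEQ_le_const2[OF lim]) (auto intro: truncated.x_le_1[OF trunc])

lemma X_linear_growth: "t \<ge> 0 \<Longrightarrow> X t k \<le> a k * t"
proof (rule LIMSEQ_le_const2[OF lim])
  assume t: "t \<ge> 0"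
  have "x i t k \<le> a k * t" if "i \<ge> k" for i
    using n_large[of i] that t by (intro truncated.x_linear_growth[OF trunc]) auto
  then show "\<exists>N. \<forall>i\<ge>N. x i t k \<le> a k * t" by blast
qed

lemma X_sq_le:
  assumes "t \<ge> 0" "\<And>i. truncated.energy (n i) (x i) k t \<le> b"
  shows "(X t k)\<^sup>2 \<le> b"
proof (rule LIMSEQ_le_const2[OF tendsto_power[OF lim[OF assms(1)]]])
  show "\<exists>N. \<forall>i\<ge>N. (x i t k)\<^sup>2 \<le> b"
    using truncated.sq_le_energy[OF trunc assms(1)] assms(2) by (meson order_trans)
qed

text \<open>Only finite sums pass to a componentwise limit. For the lower bound the energy of the
  shells above \<open>m\<close> is subtracted first; a uniform bound \<open>c\<close> on it excludes
  an escape to high shells.\<close>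

lemma X_partial_energy:
  assumes "t \<ge> 0"
  shows "(\<And>i. truncated.energy (n i) (x i) 1 t \<le> b) \<Longrightarrow> (\<Sum>j=1..m. (X t j)\<^sup>2) \<le> b"
    and "(\<And>i. b \<le> truncated.energy (n i) (x i) 1 t) \<Longrightarrow> (\<And>i. truncated.energy (n i) (x i) (Suc m) t \<le> c) \<Longrightarrow>
      b - c \<le> (\<Sum>j=1..m. (X t j)\<^sup>2)"
proof -
  have L: "(\<lambda>i. \<Sum>j=1..m. (x i t j)\<^sup>2) \<longlonglongrightarrow> (\<Sum>j=1..m. (X t j)\<^sup>2)"
    by (intro tendsto_sum tendsto_power lim assms)
  have eq: "(\<Sum>j=1..m. (x i t j)\<^sup>2) = truncated.energy (n i) (x i) 1 t - truncated.energy (n i) (x i) (Suc m) t" for i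
    using truncated.energy_split[OF trunc assms, of i m] by simp
  show "(\<Sum>j=1..m. (X t j)\<^sup>2) \<le> b" if "\<And>i. truncated.energy (n i) (x i) 1 t \<le> b"
  proof (rule LIMSEQ_le_const2[OF L])
    have "(\<Sum>j=1..m. (x i t j)\<^sup>2) \<le> b" for i
      using that[of i] truncated.energy_nonneg[OF trunc, of i "Suc m" t] unfolding eq by linarith
    then show "\<exists>N. \<forall>i\<ge>N. (\<Sum>j=1..m. (x i t j)\<^sup>2) \<le> b" by blast
  qed
  show "b - c \<le> (\<Sum>j=1..m. (X t j)\<^sup>2)"
    if "\<And>i. b \<le> truncated.energy (n i) (x i) 1 t" "\<And>i. truncated.energy (n i) (x i) (Suc m) t \<le> c"
  proof (rule LIMSEQ_le_const[OF L])
    have "b - c \<le> (\<Sum>j=1..m. (x i t j)\<^sup>2)" for i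
      using that(1)[of i] that(2)[of i] unfolding eq by linarith
    then show "\<exists>N. \<forall>i\<ge>N. b - c \<le> (\<Sum>j=1..m. (x i t j)\<^sup>2)" by blast
  qed
qed

lemma X_cont: "continuous_on {0..} (\<lambda>t. X t k)"
proof -
  define L where "L = d k + a k + a (k - 1)"
  have L: "L \<ge> 0"
    using truncated.d_nonneg[OF trunc[of 0], of k] truncated.a_nonneg[OF trunc[of 0]] by (simp add: L_def)
  have "L-lipschitz_on {0..} (\<lambda>t. X t k)"
  proof (rule lipschitz_onI[OF _ L])
    fix t s :: real assume ts: "t \<in> {0..}" "s \<in> {0..}"
    have "\<bar>X t k - X s k\<bar> \<le> L * \<bar>t - s\<bar>"
    proof (rule LIMSEQ_le_const2)
      show "(\<lambda>i. \<bar>x i t k - x i s k\<bar>) \<longlonglongrightarrow> \<bar>X t k - X s k\<bar>"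
        using ts by (intro tendsto_intros lim) auto
      show "\<exists>N. \<forall>i\<ge>N. \<bar>x i t k - x i s k\<bar> \<le> L * \<bar>t - s\<bar>"
        using truncated.x_lipschitz[OF trunc, of s t] ts by (auto simp: L_def)
    qed
    then show "dist (X t k) (X s k) \<le> L * dist t s" by (simp add: dist_real_def)
  qed
  then show ?thesis by (rule lipschitz_on_continuous_on)
qed

lemma X_integral_eq:
  assumes T: "T \<ge> 0" and k: "k \<ge> 1"
  shows "X T k = integral {0..T} (\<lambda>s. shell_rhs d a (X s) k)"
proof -
  \<comment> \<open>The shift to \<open>i + k\<close> keeps shell \<open>k\<close> strictly below
    the top shell, so its initial value is 0 for every \<open>i\<close>.\<close>
  let ?f = "\<lambda>i s. shell_rhs d a (x (i + k) s) k"
  have int: "((\<lambda>s. ?f i s) has_integral x (i + k) T k) {0..T}" for i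
  proof -
    have ki: "k \<in> {1..n (i + k)}" "k \<noteq> n (i + k)" using n_large[of "i + k"] k by auto
    have "((\<lambda>s. ?f i s) has_integral x (i + k) T k - x (i + k) 0 k) {0..T}"
    proof (rule fundamental_theorem_of_calculus[OF T])
      fix s assume s: "s \<in> {0..T}"
      show "((\<lambda>t. x (i + k) t k) has_vector_derivative ?f i s) (at s within {0..T})"
        using truncated.x_ode[OF trunc _ ki(1), of s] s
        unfolding has_real_derivative_iff_has_vector_derivative[symmetric]
        by (auto intro: DERIV_subset)
    qed
    moreover have "x (i + k) 0 k = 0"
      using truncated.init[OF trunc, of "i + k" k] ki(2) by simp
    ultimately show ?thesis by simp
  qed
  have "(\<lambda>i. integral {0..T} (?f i)) \<longlonglongrightarrow> integral {0..T} (\<lambda>s. shell_rhs d a (X s) k)"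
  proof (rule dominated_convergence(2))
    show "?f i integrable_on {0..T}" for i using int by blast
    show "(\<lambda>_. d k + a k + a (k - 1)) integrable_on {0..T}" by (rule integrable_const_ivl)
    show "norm (?f i s) \<le> d k + a k + a (k - 1)" if "s \<in> {0..T}" for i s
      using truncated.abs_rhs_le[OF trunc[of "i + k"], of s k] that by simp
    show "(\<lambda>i. ?f i s) \<longlonglongrightarrow> shell_rhs d a (X s) k" if "s \<in> {0..T}" for s
      using that by (intro tendsto_intros LIMSEQ_ignore_initial_segment[OF lim]) auto
  qed
  moreover have "integral {0..T} (?f i) = x (i + k) T k" for i
    using int by (rule integral_unique)
  moreover have "(\<lambda>i. x (i + k) T k) \<longlonglongrightarrow> X T k"
    by (rule LIMSEQ_ignore_initial_segment[OF lim[OF T]])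
  ultimately show ?thesis by (simp add: LIMSEQ_unique)
qed

lemma X_ode:
  assumes t: "t > 0" and k: "k \<ge> 1"
  shows "((\<lambda>t. X t k) has_real_derivative shell_rhs d a (X t) k) (at t)"
proof -
  let ?f = "\<lambda>s. shell_rhs d a (X s) k"
  have "continuous_on {0..t+1} ?f"
    by (intro continuous_intros continuous_on_subset[OF X_cont]) auto
  then have "((\<lambda>u. integral {0..u} ?f) has_vector_derivative ?f t) (at t within {0..t+1})"
    by (rule integral_has_vector_derivative) (use t in auto)
  moreover have "at t within {0..t+1} = at t" by (rule at_within_interior) (use t in simp)
  ultimately have "((\<lambda>u. integral {0..u} ?f) has_real_derivative ?f t) (at t)"
    by (simp add: has_real_derivative_iff_has_vector_derivative)
  then show ?thesis
    by (rule DERIV_cong_ev[THEN iffD1, rotated 3])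
      (use t k in \<open>auto intro!: eventually_mono[OF eventually_nhds_in_open[of "{0<..}" t]] simp: X_integral_eq\<close>)
qed

end

subsection \<open>Sobolev norms of the limit\<close>

lemma power_div_fact_le_exp:
  fixes y :: real
  assumes "y \<ge> 0"
  shows "y ^ n / fact n \<le> exp y"
proof -
  have "(\<Sum>k\<in>{n}. y ^ k /\<^sub>R fact k) \<le> (\<Sum>k. y ^ k /\<^sub>R fact k)"
    by (rule sum_le_suminf[OF summable_exp_generic]) (use assms in auto)
  then show ?thesis by (simp add: exp_def divide_inverse mult.commute)
qed

lemma N_powr: "lam > 0 \<Longrightarrow> N lam k powr s = (lam powr s) ^ k"
  by (simp add: N_def powr_powr mult.commute flip: powr_realpow)

text \<open>The bound \<open>exp (- y) \<le> fact n / y ^ n\<close> with \<open>s < 2 * n\<close>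
  dominates the terms by a geometric series of ratio
  \<open>lam powr s / lam ^ (2 * n)\<close>.\<close>

lemma summable_powr_exp:
  fixes lam c s :: real
  assumes lam: "lam > 1" and c: "c > 0"
  shows "summable (\<lambda>k. N lam (Suc k) powr s * exp (- c * (N lam (Suc k))\<^sup>2))"
proof -
  obtain n :: nat where n: "s < real n" using reals_Archimedean2 by blast
  define r where "r = lam powr s / lam ^ (2 * n)"
  have r: "0 < r" "r < 1"
  proof -
    have "s < real (2 * n)" using n by simp
    then have "lam powr s < lam powr real (2 * n)" using lam by (rule powr_less_mono)
    also have "lam powr real (2 * n) = lam ^ (2 * n)" using lam by (intro powr_realpow) simp
    finally show "r < 1" using lam by (simp add: r_def)
    show "0 < r" using lam by (simp add: r_def)
  qed
  have "summable (\<lambda>k. fact n / c ^ n * r ^ Suc k)"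
    using r by (intro summable_mult) (simp add: summable_Suc_iff[of "\<lambda>k. r ^ k"] summable_geometric_iff)
  then show ?thesis
  proof (rule summable_comparison_test'[where N = 0])
    fix k :: nat
    define y where "y = c * (N lam (Suc k))\<^sup>2"
    have y: "y > 0" using c lam by (simp add: y_def N_def)
    have "exp (- y) \<le> fact n / y ^ n"
      using power_div_fact_le_exp[of y n] y by (simp add: exp_minus field_simps)
    then have "N lam (Suc k) powr s * exp (- y) \<le> (lam powr s) ^ Suc k * (fact n / y ^ n)"
      using lam N_powr[of lam "Suc k" s] by (intro mult_mono) auto
    also have "y ^ n = c ^ n * (lam ^ (2 * n)) ^ Suc k"
      by (simp only: y_def N_def power_mult_distrib power_mult[symmetric] mult_ac)
    finally show "norm (N lam (Suc k) powr s * exp (- c * (N lam (Suc k))\<^sup>2)) \<le> fact n / c ^ n * r ^ Suc k"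
      by (simp add: y_def r_def power_divide mult_ac)
  qed
qed

lemma diff_sq_le:
  fixes u v b :: real
  assumes "0 \<le> u" "0 \<le> v" "u\<^sup>2 \<le> b" "v\<^sup>2 \<le> b"
  shows "(u - v)\<^sup>2 \<le> b"
proof (cases "v \<le> u")
  case True
  then have "(u - v)\<^sup>2 \<le> u\<^sup>2" using assms by (intro power_mono) auto
  then show ?thesis using assms by simp
next
  case False
  then have "(v - u)\<^sup>2 \<le> v\<^sup>2" using assms by (intro power_mono) auto
  then show ?thesis using assms by (simp add: power2_commute)
qed

text \<open>Everything about the limit that the norm estimates use. Energy bounds are stated for
  partial sums, the form that survives the limit; convergence of the full series comes from
  \<open>X_exp\<close>.\<close>

locale cascade =
  fixes \<nu> \<alpha> lam C \<sigma> :: real and X :: "real \<Rightarrow> nat \<Rightarrow> real"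
  assumes \<nu>: "\<nu> > 0" and \<alpha>: "\<alpha> > 2" and lam: "lam > 1" and C: "C \<ge> 0" and \<sigma>: "\<sigma> > 0"
    and X_nonneg: "\<And>t k. t \<ge> 0 \<Longrightarrow> X t k \<ge> 0"
    and X_cont: "\<And>k. continuous_on {0..} (\<lambda>t. X t k)"
    and X_growth: "\<And>t k. t \<ge> 0 \<Longrightarrow> X t k \<le> N lam k powr \<alpha> * t"
    and X_exp: "\<And>t k. t \<ge> 0 \<Longrightarrow> k \<ge> 1 \<Longrightarrow> (X t k)\<^sup>2 \<le> exp (- (2 * \<nu> * t) * (N lam k)\<^sup>2)"
    and X_energy: "\<And>t m. t \<ge> 0 \<Longrightarrow> (\<Sum>j=1..m. (X t j)\<^sup>2) \<le> 1"
    and X_energy_lower: "\<And>t m. 0 < t \<Longrightarrow> t \<le> 1 \<Longrightarrow>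
      1 - C * t powr \<sigma> - exp (- (2 * \<nu> * t) * (N lam (Suc m))\<^sup>2) \<le> (\<Sum>j=1..m. (X t j)\<^sup>2)"
    and X_tail: "\<And>p. 0 < p \<Longrightarrow> p < 2 \<Longrightarrow> \<exists>A>0. \<forall>k\<ge>1. \<forall>t. 0 < t \<longrightarrow> t \<le> 1 \<longrightarrow>
      (X t k)\<^sup>2 \<le> A * (N lam k powr \<alpha> * t) powr (- p)"
begin

lemma X_in_Hs:
  assumes "t > 0"
  shows "X t \<in> Hs lam s"
  unfolding Hs_def mem_Collect_eq
proof (rule summable_comparison_test'[OF summable_powr_exp[OF lam], where N = 0])
  show "0 < 2 * \<nu> * t" using \<nu> assms by simp
  show "norm (N lam (Suc k) powr (2 * s) * (X t (Suc k))\<^sup>2) \<le>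
      N lam (Suc k) powr (2 * s) * exp (- (2 * \<nu> * t) * (N lam (Suc k))\<^sup>2)" for k
    using X_exp[of t "Suc k"] assms by (auto simp: abs_mult intro!: mult_left_mono)
qed

lemma summable_Hs: "t > 0 \<Longrightarrow> summable (\<lambda>k. N lam (Suc k) powr (2 * s) * (X t (Suc k))\<^sup>2)"
  using X_in_Hs[of t s] by (simp add: Hs_def)

lemma X_tendsto: "t > 0 \<Longrightarrow> ((\<lambda>u. X u k) \<longlongrightarrow> X t k) (at t)"
  using X_cont[of k] by (auto simp: continuous_on_def at_within_atLeast_pos dest!: bspec[of _ _ t])

text \<open>Near \<open>t > 0\<close> all times exceed \<open>t / 2\<close>, and the exponential
  bound at \<open>t / 2\<close> dominates the series, so componentwise continuity suffices.\<close>

lemma X_continuous_on_Hs: "continuous_on_Hs lam s {0<..} X"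
  unfolding continuous_on_Hs_def
proof (intro conjI ballI)
  fix t :: real assume "t \<in> {0<..}"
  then have t: "t > 0" by simp
  let ?a = "\<lambda>k u. N lam (Suc k) powr (2 * s) * (X u (Suc k) - X t (Suc k))\<^sup>2"
  let ?M = "\<lambda>k. N lam (Suc k) powr (2 * s) * exp (- (2 * \<nu> * (t / 2)) * (N lam (Suc k))\<^sup>2)"
  have "((\<lambda>u. \<Sum>k. ?a k u) \<longlongrightarrow> (\<Sum>k::nat. 0)) (at t)"
  proof (rule tannerys_theorem[THEN conjunct2, THEN conjunct2])
    show "(?a k \<longlongrightarrow> 0) (at t)" for k
      by (rule tendsto_eq_intros X_tendsto t refl | simp)+
    have dec: "(X u (Suc k))\<^sup>2 \<le> exp (- (2 * \<nu> * (t / 2)) * (N lam (Suc k))\<^sup>2)" if "u \<ge> t / 2" for u k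
    proof -
      have "(X u (Suc k))\<^sup>2 \<le> exp (- (2 * \<nu> * u) * (N lam (Suc k))\<^sup>2)"
        using that t by (intro X_exp) auto
      also have "\<dots> \<le> exp (- (2 * \<nu> * (t / 2)) * (N lam (Suc k))\<^sup>2)"
        unfolding exp_le_cancel_iff by (intro mult_right_mono) (use that \<nu> in auto)
      finally show ?thesis .
    qed
    have "\<bar>?a k u\<bar> \<le> ?M k" if "u \<in> {t / 2<..}" for u k
      using that t dec[of u k] dec[of t k]
      by (auto simp: abs_mult intro!: mult_left_mono diff_sq_le X_nonneg)
    then have "\<forall>\<^sub>F u in at t. \<forall>k. \<bar>?a k u\<bar> \<le> ?M k"
      using t by (intro eventually_mono[OF eventually_at_in_open'[of "{t / 2<..}" t]]) auto
    then show "\<forall>\<^sub>F (k, u) in at_top \<times>\<^sub>F at t. norm (?a k u) \<le> ?M k"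
      unfolding eventually_prod_filter
      by (intro exI[of _ "\<lambda>_. True"] exI[of _ "\<lambda>u. \<forall>k. \<bar>?a k u\<bar> \<le> ?M k"]) auto
    show "summable ?M" using \<nu> t by (intro summable_powr_exp lam) simp
  qed simp
  then have "((\<lambda>u. sqrt (\<Sum>k. ?a k u)) \<longlongrightarrow> sqrt 0) (at t)" by (intro tendsto_real_sqrt) simp
  then show "((\<lambda>u. Hs_norm lam s (\<lambda>k. X u k - X t k)) \<longlongrightarrow> 0) (at t within {0<..})"
    using t by (simp add: Hs_norm_def at_within_open[of t "{0<..}"])
qed (simp add: X_in_Hs)

lemma X_tendsto_0: "((\<lambda>t. X t k) \<longlongrightarrow> 0) (at_right 0)"
proof (rule tendsto_sandwich)
  show "\<forall>\<^sub>F t in at_right 0. 0 \<le> X t k"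
    by (rule eventually_mono[OF eventually_at_right_less]) (auto intro: X_nonneg)
  show "\<forall>\<^sub>F t in at_right 0. X t k \<le> N lam k powr \<alpha> * t"
    by (rule eventually_mono[OF eventually_at_right_less]) (auto intro: X_growth)
  show "((\<lambda>t. N lam k powr \<alpha> * t) \<longlongrightarrow> 0) (at_right 0)" by (auto intro!: tendsto_eq_intros)
qed simp

definition total :: "real \<Rightarrow> real" where "total t = (\<Sum>k. (X t (Suc k))\<^sup>2)"

lemma N_pos: "N lam k > 0" using lam by (simp add: N_def)

lemma summable_total: "t > 0 \<Longrightarrow> summable (\<lambda>k. (X t (Suc k))\<^sup>2)"
  using summable_Hs[of t 0] N_pos[of "Suc _"] by (simp add: less_imp_neq[symmetric])

lemma total_le: "t > 0 \<Longrightarrow> total t \<le> 1"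
  unfolding total_def using X_energy[of t]
  by (intro suminf_le_const summable_total) (simp_all add: sum.atLeast1_atMost_eq)

text \<open>At a fixed positive time the exponential tail term vanishes as \<open>m\<close> grows,
  which leaves only the loss by damping.\<close>

lemma total_ge:
  assumes t: "0 < t" "t \<le> 1"
  shows "1 - C * t powr \<sigma> \<le> total t"
proof -
  let ?e = "\<lambda>m. exp (- (2 * \<nu> * t) * (N lam (Suc m))\<^sup>2)"
  have "summable (\<lambda>m. N lam (Suc m) powr 0 * ?e m)" using \<nu> t by (intro summable_powr_exp lam) simp
  then have "?e \<longlonglongrightarrow> 0" using N_pos[of "Suc _"] by (auto dest!: summable_LIMSEQ_zero simp: less_imp_neq[symmetric])
  then have "(\<lambda>m. 1 - C * t powr \<sigma> - ?e m) \<longlonglongrightarrow> 1 - C * t powr \<sigma> - 0" by (intro tendsto_intros)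
  moreover have "1 - C * t powr \<sigma> - ?e m \<le> total t" for m
  proof -
    have "(\<Sum>j=1..m. (X t j)\<^sup>2) = (\<Sum>k<m. (X t (Suc k))\<^sup>2)" by (simp add: sum.atLeast1_atMost_eq)
    also have "\<dots> \<le> total t" unfolding total_def using t by (intro sum_le_suminf summable_total) auto
    finally show ?thesis using X_energy_lower[OF t, of m] by simp
  qed
  ultimately show ?thesis by (intro LIMSEQ_le_const2[of _ "1 - C * t powr \<sigma>"]) auto
qed

lemma tendsto_C_powr: "((\<lambda>t. C * t powr \<sigma>) \<longlongrightarrow> 0) (at_right 0)"
proof -
  have "\<forall>\<^sub>F t in at_right (0::real). 0 \<le> t"
    by (rule eventually_mono[OF eventually_at_right_less]) simp
  then have "((\<lambda>t::real. t powr \<sigma>) \<longlongrightarrow> 0 powr \<sigma>) (at_right 0)"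
    using \<sigma> tendsto_powr'[OF tendsto_ident_at tendsto_const] by blast
  then show ?thesis by (auto intro: tendsto_mult_right_zero)
qed

lemma ell2_norm_tendsto: "((\<lambda>t. ell2_norm lam (X t)) \<longlongrightarrow> 1) (at_right 0)"
proof -
  have ev: "\<forall>\<^sub>F t in at_right 0. t \<in> {0<..1::real}"
    using eventually_at_right_real[of 0 "1::real"] by (auto elim!: eventually_mono)
  have "(total \<longlongrightarrow> 1) (at_right 0)"
  proof (rule tendsto_sandwich)
    show "\<forall>\<^sub>F t in at_right 0. 1 - C * t powr \<sigma> \<le> total t"
      using ev by eventually_elim (auto intro: total_ge)
    show "\<forall>\<^sub>F t in at_right 0. total t \<le> 1"
      using ev by eventually_elim (auto intro: total_le)
    show "((\<lambda>t. 1 - C * t powr \<sigma>) \<longlongrightarrow> 1) (at_right 0)"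
      using tendsto_diff[OF tendsto_const tendsto_C_powr, of 1] by simp
  qed simp
  then have "((\<lambda>t. sqrt (total t)) \<longlongrightarrow> sqrt 1) (at_right 0)" by (rule tendsto_real_sqrt)
  moreover have "ell2_norm lam (X t) = sqrt (total t)" for t
    using N_pos[of "Suc _"] by (simp add: Hs_norm_def total_def less_imp_neq[symmetric])
  ultimately show ?thesis by simp
qed

section \<open>Blow-up rate of the Sobolev norms at time zero\<close>

definition q :: real where "q = lam powr \<alpha>"

lemma q_gt_1: "q > 1" using lam \<alpha> by (simp add: q_def)

lemma N_alpha: "N lam k powr \<alpha> = q ^ k" using lam by (simp add: N_powr q_def)

lemma N_powr_q: "N lam k powr (2 * s) = (q ^ k) powr (2 * (s / \<alpha>))"
proof -
  have "(q ^ k) powr (2 * (s / \<alpha>)) = N lam k powr (\<alpha> * (2 * (s / \<alpha>)))"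
    by (simp only: N_alpha[symmetric] powr_powr)
  also have "\<alpha> * (2 * (s / \<alpha>)) = 2 * s" using \<alpha> by simp
  finally show ?thesis by simp
qed

lemma low_modes_energy:
  assumes t: "t > 0" and c: "c > 0"
  shows "(\<Sum>k=1..m. if q ^ k * t \<le> c then (X t k)\<^sup>2 else 0) \<le> q\<^sup>2 / (q\<^sup>2 - 1) * c\<^sup>2"
proof -
  define D where "D = q\<^sup>2 / (q\<^sup>2 - 1)"
  have q2: "q\<^sup>2 > 1" using q_gt_1 by (simp add: one_less_power)
  have D: "D \<ge> 0" using q2 by (simp add: D_def)
  have "(\<Sum>k=1..m. if q ^ k * t \<le> c then (X t k)\<^sup>2 else 0) \<le> D * (min c (q ^ m * t))\<^sup>2"
  proof (induction m)
    case 0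
    then show ?case using D by simp
  next
    case (Suc m)
    have le: "q ^ m * t \<le> q ^ Suc m * t" using q_gt_1 t by (intro mult_right_mono power_increasing) auto
    show ?case
    proof (cases "q ^ Suc m * t \<le> c")
      case True
      have "(X t (Suc m))\<^sup>2 \<le> (q ^ Suc m * t)\<^sup>2"
        using X_growth[of t "Suc m"] X_nonneg[of t "Suc m"] t by (intro power_mono) (auto simp: N_alpha)
      moreover have "D * (q ^ m * t)\<^sup>2 + (q ^ Suc m * t)\<^sup>2 = D * (q ^ Suc m * t)\<^sup>2"
      proof -
        have "D + q\<^sup>2 = D * q\<^sup>2" using q2 by (simp add: D_def field_simps)
        then have "(D + q\<^sup>2) * (q ^ m * t)\<^sup>2 = D * q\<^sup>2 * (q ^ m * t)\<^sup>2" by simp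
        then show ?thesis by (simp add: power_mult_distrib algebra_simps)
      qed
      ultimately show ?thesis using Suc True le by (simp add: min_absorb2)
    next
      case False
      have "D * (min c (q ^ m * t))\<^sup>2 \<le> D * (min c (q ^ Suc m * t))\<^sup>2"
        by (intro mult_left_mono power_mono min.mono order_refl le D) (use c t q_gt_1 in auto)
      then show ?thesis using Suc False by simp
    qed
  qed
  also have "\<dots> \<le> D * c\<^sup>2" using c t q_gt_1 D by (intro mult_left_mono power_mono) auto
  finally show ?thesis by (simp add: D_def)
qed

text \<open>Split the shells at \<open>q ^ k * t = c\<close>. Above the threshold the weight
  \<open>N lam k powr (2 * s)\<close> is at least
  \<open>(c / t) powr (2 * (s / \<alpha>))\<close>.\<close>

lemma total_le_Hs:
  assumes t: "t > 0" and c: "c > 0" and s: "s > 0"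
  shows "total t \<le> q\<^sup>2 / (q\<^sup>2 - 1) * c\<^sup>2 + (t / c) powr (2 * (s / \<alpha>)) * (Hs_norm lam s (X t))\<^sup>2"
proof -
  let ?h = "\<lambda>k. N lam (Suc k) powr (2 * s) * (X t (Suc k))\<^sup>2"
  have H: "(Hs_norm lam s (X t))\<^sup>2 = (\<Sum>k. ?h k)"
    unfolding Hs_norm_def using summable_Hs[OF t, of s] by (simp add: suminf_nonneg)
  have mode: "(X t k)\<^sup>2 \<le> (if q ^ k * t \<le> c then (X t k)\<^sup>2 else 0) +
      (t / c) powr (2 * (s / \<alpha>)) * (N lam k powr (2 * s) * (X t k)\<^sup>2)" for k
  proof (cases "q ^ k * t \<le> c")
    case False
    have "1 \<le> (q ^ k * t / c) powr (2 * (s / \<alpha>))"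
      using False c s \<alpha> by (intro ge_one_powr_ge_zero) auto
    also have "\<dots> = (t / c) powr (2 * (s / \<alpha>)) * N lam k powr (2 * s)"
      unfolding N_powr_q using q_gt_1 t c by (simp add: powr_mult powr_divide)
    finally have "1 * (X t k)\<^sup>2 \<le> (t / c) powr (2 * (s / \<alpha>)) * N lam k powr (2 * s) * (X t k)\<^sup>2"
      by (intro mult_right_mono) auto
    then show ?thesis using False by (simp add: mult.assoc)
  qed simp
  show ?thesis
    unfolding total_def H
  proof (rule suminf_le_const[OF summable_total[OF t]])
    fix m
    have "(\<Sum>k<m. (X t (Suc k))\<^sup>2) \<le> (\<Sum>k<m. (if q ^ Suc k * t \<le> c then (X t (Suc k))\<^sup>2 else 0) +
        (t / c) powr (2 * (s / \<alpha>)) * ?h k)"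
      by (intro sum_mono mode)
    also have "\<dots> = (\<Sum>k=1..m. if q ^ k * t \<le> c then (X t k)\<^sup>2 else 0) + (t / c) powr (2 * (s / \<alpha>)) * (\<Sum>k<m. ?h k)"
      by (simp add: sum.distrib sum_distrib_left sum.atLeast1_atMost_eq)
    also have "\<dots> \<le> q\<^sup>2 / (q\<^sup>2 - 1) * c\<^sup>2 + (t / c) powr (2 * (s / \<alpha>)) * (\<Sum>k. ?h k)"
      by (intro add_mono mult_left_mono low_modes_energy t c sum_le_suminf summable_Hs) auto
    finally show "(\<Sum>k<m. (X t (Suc k))\<^sup>2) \<le> \<dots>" .
  qed
qed

text \<open>For small \<open>t\<close> the total energy exceeds 3/4, while the shells with
  \<open>q ^ k * t \<le> c\<close> hold at most 1/4; the rest sits where the weight is large. The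
  time \<open>t0\<close> serves all \<open>s\<close>.\<close>

lemma Hs_norm_lower:
  "\<exists>t0>0. t0 \<le> 1 \<and> (\<forall>s>0. \<exists>K>0. \<forall>t. 0 < t \<longrightarrow> t \<le> t0 \<longrightarrow> t powr (- s / \<alpha>) \<le> K * Hs_norm lam s (X t))"
proof -
  have "\<forall>\<^sub>F t in at_right 0. C * t powr \<sigma> < 1 / 4"
    using order_tendstoD(2)[OF tendsto_C_powr, of "1 / 4"] by simp
  then obtain b where b: "b > 0" "\<And>t. 0 < t \<Longrightarrow> t < b \<Longrightarrow> C * t powr \<sigma> < 1 / 4"
    by (auto simp: eventually_at_right_field)
  define t0 where "t0 = min 1 (b / 2)"
  have t0: "t0 > 0" "t0 \<le> 1" "t0 < b" using b(1) by (auto simp: t0_def)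
  define D where "D = q\<^sup>2 / (q\<^sup>2 - 1)"
  have "q\<^sup>2 > 1" using q_gt_1 by (simp add: one_less_power)
  then have D: "D > 0" unfolding D_def by (intro divide_pos_pos) auto
  define c where "c = 1 / (2 * sqrt D)"
  have c: "c > 0" "D * c\<^sup>2 = 1 / 4" using D by (auto simp: c_def power_divide power_mult_distrib)
  show ?thesis
  proof (rule exI[of _ t0], intro conjI allI impI t0)
    fix s :: real assume s: "s > 0"
    define \<kappa> where "\<kappa> = s / \<alpha>"
    have \<kappa>: "\<kappa> > 0" using s \<alpha> by (simp add: \<kappa>_def)
    show "\<exists>K>0. \<forall>t. 0 < t \<longrightarrow> t \<le> t0 \<longrightarrow> t powr (- s / \<alpha>) \<le> K * Hs_norm lam s (X t)"
    proof (intro exI[of _ "2 / c powr \<kappa>"] conjI allI impI)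
      show "2 / c powr \<kappa> > 0" using c by simp
      fix t assume t: "0 < t" "t \<le> t0"
      define H where "H = Hs_norm lam s (X t)"
      have H: "H \<ge> 0" unfolding H_def Hs_norm_def using summable_Hs[OF t(1), of s] by (simp add: suminf_nonneg)
      have "1 - C * t powr \<sigma> \<le> total t" using t t0 by (intro total_ge) auto
      moreover have "C * t powr \<sigma> < 1 / 4" using t t0 by (intro b(2)) auto
      moreover have "total t \<le> D * c\<^sup>2 + (t / c) powr (2 * \<kappa>) * H\<^sup>2"
        using total_le_Hs[OF t(1) c(1) s] by (simp add: D_def \<kappa>_def H_def)
      \<comment> \<open>The remainder 1/2 is weakened to 1/4 so that taking roots is clean.\<close>
      ultimately have "(1 / 2)\<^sup>2 \<le> (t / c) powr (2 * \<kappa>) * H\<^sup>2" unfolding c(2) by (simp add: power2_eq_square)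
      also have "\<dots> = ((t / c) powr \<kappa> * H)\<^sup>2"
        using t c by (simp add: power_mult_distrib powr_power mult.commute)
      finally have "1 / 2 \<le> (t / c) powr \<kappa> * H" by (rule power2_le_imp_le) (use H in simp)
      then have "1 / 2 \<le> t powr \<kappa> / c powr \<kappa> * H" using t c by (simp add: powr_divide)
      then have "t powr (- \<kappa>) \<le> 2 / c powr \<kappa> * H" using t c by (simp add: powr_minus field_simps)
      then show "t powr (- s / \<alpha>) \<le> 2 / c powr \<kappa> * Hs_norm lam s (X t)" by (simp add: \<kappa>_def H_def)
    qed
  qed
qed

lemma X_le_1: "t \<ge> 0 \<Longrightarrow> k \<ge> 1 \<Longrightarrow> (X t k)\<^sup>2 \<le> 1"
  using member_le_sum[of k "{1..k}" "\<lambda>j. (X t j)\<^sup>2"] X_energy[of t k] by auto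

text \<open>With tail exponent \<open>2 * (\<kappa> + \<eta>)\<close> the weight
  \<open>q ^ k\<close> to the power \<open>2 * \<kappa>\<close> is beaten by \<open>q\<close> to the
  power \<open>- 2 * \<eta> * k\<close>, and the time factor is the square of
  \<open>t powr (- (\<kappa> + \<eta>))\<close>.\<close>

lemma Hs_norm_upper:
  assumes s: "0 < s" "s < \<alpha>" and \<epsilon>: "\<epsilon> > 0"
  shows "\<exists>K>0. \<forall>t. 0 < t \<longrightarrow> t \<le> 1 \<longrightarrow> Hs_norm lam s (X t) \<le> K * t powr (- s / \<alpha> - \<epsilon>)"
proof -
  define \<kappa> where "\<kappa> = s / \<alpha>"
  have \<kappa>: "0 < \<kappa>" "\<kappa> < 1" using s \<alpha> by (auto simp: \<kappa>_def)
  \<comment> \<open>The tail bound admits only exponents below 2, hence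
    \<open>\<kappa> + \<eta> < 1\<close>; \<open>s < \<alpha>\<close> leaves room for a positive
    \<open>\<eta>\<close>.\<close>
  define \<eta> where "\<eta> = min \<epsilon> ((1 - \<kappa>) / 2)"
  have \<eta>: "0 < \<eta>" "\<eta> \<le> \<epsilon>" "\<kappa> + \<eta> < 1" using \<kappa> \<epsilon> by (auto simp: \<eta>_def min_def field_simps)
  obtain A where A: "A > 0" and tail: "\<And>k t. k \<ge> 1 \<Longrightarrow> 0 < t \<Longrightarrow> t \<le> 1 \<Longrightarrow>
      (X t k)\<^sup>2 \<le> A * (N lam k powr \<alpha> * t) powr (- (2 * (\<kappa> + \<eta>)))"
    using X_tail[of "2 * (\<kappa> + \<eta>)"] \<kappa> \<eta> by auto
  define r where "r = q powr (- 2 * \<eta>)"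
  have r: "0 < r" "r < 1" using q_gt_1 \<eta> powr_less_mono[of "- 2 * \<eta>" 0 q] by (auto simp: r_def)
  have sr: "summable (\<lambda>k. r ^ Suc k)"
    using r by (simp add: summable_Suc_iff[of "\<lambda>k. r ^ k"] summable_geometric_iff)
  define R where "R = (\<Sum>k. r ^ Suc k)"
  have R: "R > 0" unfolding R_def using r by (intro suminf_pos sr) auto
  show ?thesis
  proof (intro exI[of _ "sqrt (A * R)"] conjI allI impI)
    show "sqrt (A * R) > 0" using A R by simp
    fix t :: real assume t: "0 < t" "t \<le> 1"
    define w where "w = t powr (- (\<kappa> + \<eta>))"
    have w: "w > 0" using t by (simp add: w_def)
    have "(\<Sum>k. N lam (Suc k) powr (2 * s) * (X t (Suc k))\<^sup>2) \<le> (\<Sum>k. A * w\<^sup>2 * r ^ Suc k)"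
    proof (rule suminf_le)
      fix k
      define z where "z = q ^ Suc k"
      have z: "z > 0" using q_gt_1 by (simp add: z_def)
      have "N lam (Suc k) powr (2 * s) * (X t (Suc k))\<^sup>2 \<le> z powr (2 * \<kappa>) * (A * (z * t) powr (- (2 * (\<kappa> + \<eta>))))"
        using tail[of "Suc k" t] t unfolding N_powr_q N_alpha z_def[symmetric] \<kappa>_def[symmetric]
        by (intro mult_left_mono) auto
      also have "(z * t) powr (- (2 * (\<kappa> + \<eta>))) = z powr (- 2 * \<kappa>) * z powr (- 2 * \<eta>) * w\<^sup>2"
        using z t by (simp add: powr_mult w_def powr_power algebra_simps flip: powr_add)
      also have "z powr (2 * \<kappa>) * (A * (z powr (- 2 * \<kappa>) * z powr (- 2 * \<eta>) * w\<^sup>2)) = A * w\<^sup>2 * z powr (- 2 * \<eta>)"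
        using z by (simp add: powr_minus field_simps)
      also have "z powr (- 2 * \<eta>) = r ^ Suc k"
        using q_gt_1 unfolding z_def r_def
        by (subst powr_realpow[symmetric], simp, subst powr_powr, subst mult.commute, subst powr_powr[symmetric])
          (rule powr_realpow, simp)
      finally show "N lam (Suc k) powr (2 * s) * (X t (Suc k))\<^sup>2 \<le> A * w\<^sup>2 * r ^ Suc k" .
    qed (use summable_Hs[OF t(1)] in \<open>auto intro!: summable_mult sr simp del: power_Suc\<close>)
    also have "\<dots> = A * R * w\<^sup>2" unfolding R_def by (subst suminf_mult[OF sr]) simp
    finally have "Hs_norm lam s (X t) \<le> sqrt (A * R * w\<^sup>2)"
      unfolding Hs_norm_def by (rule real_sqrt_le_mono)
    also have "\<dots> = sqrt (A * R) * w" using w by (simp add: real_sqrt_mult)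
    also have "w \<le> t powr (- s / \<alpha> - \<epsilon>)"
      unfolding w_def using t \<eta> by (intro powr_mono') (auto simp: \<kappa>_def)
    finally show "Hs_norm lam s (X t) \<le> sqrt (A * R) * t powr (- s / \<alpha> - \<epsilon>)"
      using A R by (simp add: mult_left_mono)
  qed
qed

end

section \<open>Construction of the solution and conclusion\<close>

lemma cascade_exists:
  fixes \<nu> \<alpha> lam :: real
  assumes \<nu>: "\<nu> > 0" and \<alpha>: "\<alpha> > 2" and lam: "lam > 1"
  shows "\<exists>C \<sigma> X. cascade \<nu> \<alpha> lam C \<sigma> X \<and> is_solution \<nu> \<alpha> lam X"
proof -
  define q where "q = lam powr \<alpha>"
  define l where "l = lam\<^sup>2"
  define d where "d = (\<lambda>k. \<nu> * l ^ k)"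
  define a where "a = (\<lambda>k::nat. q ^ k)"
  have l1: "1 < l" using lam by (simp add: l_def one_less_power)
  have lq: "l < q"
    using powr_less_mono[OF \<alpha> lam] lam by (simp add: l_def q_def)
  have N2: "(N lam k)\<^sup>2 = l ^ k" for k by (simp add: N_def l_def mult.commute flip: power_mult)
  have Na: "N lam k powr \<alpha> = q ^ k" for k using lam by (simp add: N_powr q_def)
  have d_mono: "d i \<le> d j" if "i \<le> j" for i j
    unfolding d_def using that \<nu> l1 by (auto intro: power_increasing)
  have "\<exists>x. truncated d a (Suc i) x" for i
    using \<nu> l1 lq by (intro truncated_exists) (auto simp: d_def a_def)
  then obtain Y where Y: "\<And>i. truncated d a (Suc i) (Y i)" by metis
  obtain r X where r: "strict_mono (r :: nat \<Rightarrow> nat)"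
    and conv: "\<And>k t. t \<ge> 0 \<Longrightarrow> (\<lambda>i. Y (r i) t k) \<longlonglongrightarrow> X k t"
  proof (rule equi_lipschitz_subsequence[of "\<lambda>i k t. Y i t k" 1 "\<lambda>k. d k + a k + a (k - 1)"])
    show "\<bar>Y n t k\<bar> \<le> 1" if "t \<ge> 0" for n k t
      using truncated.x_nonneg[OF Y that, of n k] truncated.x_le_1[OF Y that, of n k] by simp
  qed (use truncated.x_lipschitz[OF Y] in auto)
  define Z where "Z t k = X k t" for t k
  interpret truncation_limit d a "\<lambda>i. Suc (r i)" "\<lambda>i. Y (r i)" Z
    by (rule truncation_limit.intro) (use Y conv seq_suble[OF r] in \<open>simp_all add: Z_def less_Suc_eq_le\<close>)
  obtain C \<sigma> where \<sigma>: "0 < \<sigma>" and C: "0 \<le> C"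
    and low: "\<And>n x t. truncated d a n x \<Longrightarrow> 0 \<le> t \<Longrightarrow> t \<le> 1 \<Longrightarrow> 1 - C * t powr \<sigma> \<le> truncated.energy n x 1 t"
    using energy_lower_uniform[OF \<nu> l1 lq] unfolding d_def a_def by blast
  have exp: "truncated.energy n x k t \<le> exp (- (2 * \<nu> * t) * (N lam k)\<^sup>2)"
    if "truncated d a n x" "t \<ge> 0" "k \<ge> 1" for n x k t
    using truncated.energy_exp_decay[OF that(1-3) d_mono] by (simp add: N2 d_def mult_ac)
  have "cascade \<nu> \<alpha> lam C \<sigma> Z"
  proof
    show "Z t k \<le> N lam k powr \<alpha> * t" if "t \<ge> 0" for t k
      using X_linear_growth[OF that, of k] by (simp add: Na a_def)
    show "(Z t k)\<^sup>2 \<le> exp (- (2 * \<nu> * t) * (N lam k)\<^sup>2)" if "t \<ge> 0" "k \<ge> 1" for t k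
      using that by (intro X_sq_le exp[OF trunc]) auto
    show "(\<Sum>j=1..m. (Z t j)\<^sup>2) \<le> 1" if "t \<ge> 0" for t m
      using that by (intro X_partial_energy(1) truncated.energy_le_1[OF trunc]) auto
    show "1 - C * t powr \<sigma> - exp (- (2 * \<nu> * t) * (N lam (Suc m))\<^sup>2) \<le> (\<Sum>j=1..m. (Z t j)\<^sup>2)"
      if "0 < t" "t \<le> 1" for t m
      using that by (intro X_partial_energy(2) exp[OF trunc] low[OF trunc]) auto
    show "\<exists>A>0. \<forall>k\<ge>1. \<forall>t. 0 < t \<longrightarrow> t \<le> 1 \<longrightarrow> (Z t k)\<^sup>2 \<le> A * (N lam k powr \<alpha> * t) powr (- p)"
      if p: "0 < p" "p < 2" for p
    proof -
      \<comment> \<open>Enough bootstrap rounds for the exponent \<open>2 - (1 / 2) ^ m\<close> to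
        exceed \<open>p\<close>; interpolation with the bound 1 then lowers it to
        \<open>p\<close>.\<close>
      obtain m where m: "(1 / 2) ^ m < 2 - p"
        using real_arch_pow_inv[of "2 - p" "1 / 2"] p by auto
      obtain A where A: "A \<ge> 0" and en: "\<And>n x k t. truncated d a n x \<Longrightarrow> k \<ge> 1 \<Longrightarrow> 0 < t \<Longrightarrow> t \<le> 1 \<Longrightarrow>
          truncated.energy n x k t \<le> A * (q ^ k * t) powr (- (2 - (1 / 2) ^ m))"
        using tail_bound_uniform[of q 1 d m] d_mono l1 lq unfolding a_def by auto
      show ?thesis
      proof (intro exI[of _ "max A 1"] conjI allI impI)
        fix k :: nat and t :: real assume k: "1 \<le> k" and t: "0 < t" "t \<le> 1"
        have "(Z t k)\<^sup>2 \<le> A * (q ^ k * t) powr (- (2 - (1 / 2) ^ m))"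
          using t k by (intro X_sq_le en[OF trunc]) auto
        also have "\<dots> \<le> max A 1 * (q ^ k * t) powr (- (2 - (1 / 2) ^ m))"
          by (intro mult_right_mono) auto
        finally have le: "(Z t k)\<^sup>2 \<le> max A 1 * (q ^ k * t) powr (- (2 - (1 / 2) ^ m))" .
        have "(Z t k)\<^sup>2 \<le> 1" using X_nonneg[of t k] X_le_1[of t k] t by (simp add: power_le_one)
        then show "(Z t k)\<^sup>2 \<le> max A 1 * (N lam k powr \<alpha> * t) powr (- p)"
          unfolding Na using le
        proof (rule le_powr_interpolate)
          show "0 \<le> p" using p by simp
          show "p \<le> 2 - (1 / 2) ^ m" using m by simp
          show "1 \<le> max A 1" by simp
          show "0 < q ^ k * t" using l1 lq t by simp
        qed
      qed simp
    qed
  qed (use \<nu> \<alpha> lam C \<sigma> X_nonneg X_cont in auto)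
  moreover have "is_solution \<nu> \<alpha> lam Z"
    unfolding is_solution_def
  proof (intro conjI allI impI)
    fix k :: nat assume k: "1 \<le> k"
    show "continuous_on {0<..} (\<lambda>t. Z t k)" by (rule continuous_on_subset[OF X_cont]) auto
    fix t :: real assume t: "0 < t"
    show "((\<lambda>t. Z t k) has_real_derivative - \<nu> * (N lam k)\<^sup>2 * Z t k + N lam k powr \<alpha> * (Z t (k + 1))\<^sup>2
        - N lam (k - 1) powr \<alpha> * Z t (k - 1) * Z t k) (at t)"
      using X_ode[OF t k] by (simp add: d_def a_def N2 Na)
  qed (use X_zero in auto)
  ultimately show ?thesis by blast
qed

theorem theorem1p4:
  fixes \<nu> \<alpha> lam :: real
  assumes "\<nu> > 0" and "\<alpha> > 2" and "lam > 1"
  shows "\<exists>X :: real \<Rightarrow> nat \<Rightarrow> real.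
    (\<forall>s. continuous_on_Hs lam s {0<..} X) \<and>
    is_solution \<nu> \<alpha> lam X \<and>
    (\<forall>k\<ge>1. ((\<lambda>t. X t k) \<longlongrightarrow> 0) (at_right 0)) \<and>
    ((\<lambda>t. ell2_norm lam (X t)) \<longlongrightarrow> 1) (at_right 0) \<and>
    (\<forall>s. 0 < s \<and> s < \<alpha> \<longrightarrow>
      (\<exists>t\<^sub>s>0.
        (\<exists>C>0. \<forall>t. 0 < t \<and> t \<le> t\<^sub>s \<longrightarrow>
           t powr (- s / \<alpha>) \<le> C * Hs_norm lam s (X t)) \<and>
        (\<forall>\<epsilon>>0. \<exists>C>0. \<forall>t. 0 < t \<and> t \<le> t\<^sub>s \<longrightarrow>
           Hs_norm lam s (X t) \<le> C * t powr (- s / \<alpha> - \<epsilon>))))"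
proof -
  obtain C \<sigma> X where "cascade \<nu> \<alpha> lam C \<sigma> X" and sol: "is_solution \<nu> \<alpha> lam X"
    using cascade_exists[OF assms] by blast
  interpret cascade \<nu> \<alpha> lam C \<sigma> X by fact
  obtain t0 where t0: "t0 > 0" "t0 \<le> 1"
    and lower: "\<And>s. s > 0 \<Longrightarrow> \<exists>K>0. \<forall>t. 0 < t \<longrightarrow> t \<le> t0 \<longrightarrow> t powr (- s / \<alpha>) \<le> K * Hs_norm lam s (X t)"
    using Hs_norm_lower by blast
  show ?thesis
  proof (intro exI[of _ X] conjI allI impI)
    fix s :: real assume s: "0 < s \<and> s < \<alpha>"
    show "\<exists>t\<^sub>s>0. (\<exists>C>0. \<forall>t. 0 < t \<and> t \<le> t\<^sub>s \<longrightarrow> t powr (- s / \<alpha>) \<le> C * Hs_norm lam s (X t)) \<and>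
        (\<forall>\<epsilon>>0. \<exists>C>0. \<forall>t. 0 < t \<and> t \<le> t\<^sub>s \<longrightarrow> Hs_norm lam s (X t) \<le> C * t powr (- s / \<alpha> - \<epsilon>))"
    \<comment> \<open>One \<open>t0\<close> serves as \<open>t\<^sub>s\<close> for every
      \<open>s\<close>; \<open>t0 \<le> 1\<close> puts it in the range of the upper bound, whose
      constant alone depends on the chosen \<open>\<epsilon>\<close>.\<close>
    proof (rule exI[of _ t0], intro conjI allI impI)
      show "\<exists>C>0. \<forall>t. 0 < t \<and> t \<le> t0 \<longrightarrow> t powr (- s / \<alpha>) \<le> C * Hs_norm lam s (X t)"
        using lower[of s] s by auto
      fix \<epsilon> :: real assume "\<epsilon> > 0"
      then obtain K where "K > 0" "\<And>t. 0 < t \<Longrightarrow> t \<le> 1 \<Longrightarrow> Hs_norm lam s (X t) \<le> K * t powr (- s / \<alpha> - \<epsilon>)"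
        using Hs_norm_upper[of s \<epsilon>] s by blast
      then show "\<exists>C>0. \<forall>t. 0 < t \<and> t \<le> t0 \<longrightarrow> Hs_norm lam s (X t) \<le> C * t powr (- s / \<alpha> - \<epsilon>)"
        using t0 by (intro exI[of _ K]) auto
    qed (rule t0)
  qed (use X_continuous_on_Hs sol X_tendsto_0 ell2_norm_tendsto in auto)
qed

end
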